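(* Let $\gamma>0$ and let $F$ be the generalized Gaussian distribution with density $f(x)\propto\exp(-|x|^\gamma/\gamma)$ on $\mathbb{R}$. For each $n$, let $X_1,\dots,X_m$ be drawn iid from $F$ and, independently, $Y_1,\dots,Y_n$ be drawn iid from $G$, where $m=m_n$, and consider testing $$\mathcal{H}_0: G = F \quad\text{versus}\quad \mathcal{H}_1: G = (1-\varepsilon_n)F + \varepsilon_n F(\cdot-\mu_n),$$ where $\varepsilon_n=n^{-\beta}$ with $0<\beta<1$ fixed. Assume that $m,n\to\infty$ with $\frac{n}{m+n}\to\eta\in(0,1/2]$ and $\left|\frac{n}{m+n}-\eta\right| = O(\log n/\sqrt n)$. Then the two-sample higher criticism test is asymptotically powerful in each of the following cases. (i) (Sparse regime) $1/2<\beta<1$, $\mu_n=(\gamma r\log n)^{1/\gamma}$ with $0<r<1$ fixed, and $r>\rho^*_\gamma(\beta)$, where for $\gamma>1$ $$\rho^*_\gamma(\beta)=\begin{cases}(2^{1/(\gamma-1)}-1)^{\gamma-1}\,(\beta-\tfrac12), & \tfrac12<\beta<1-2^{-\gamma/(\gamma-1)},\\ \big(1-(1-\beta)^{1/\gamma}\big)^\gamma, & 1-2^{-\gamma/(\gamma-1)}<\beta<1,\end{cases}$$ and for $\gamma\le 1$, $\rho^*_\gamma(\beta)=2\beta-1$. (ii) (Dense regime) $0<\beta<1/2$, $\mu_n=n^{s-1/2}$ with $0<s<1/2$ fixed, and $s>\beta$.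
   Context: All limits are as $n\to\infty$. Two-sample higher criticism statistic: let $F_m$ and $G_n$ be the empirical distribution functions of the $X$-sample and $Y$-sample, and $H_{m+n}=\frac{1}{m+n}(mF_m+nG_n)$ that of the combined sample. Then $$\mathrm{HC}=\sup_{t}\ \sqrt{\frac{mn}{m+n}}\;\frac{F_m(t)-G_n(t)}{\sqrt{H_{m+n}(t)(1-H_{m+n}(t))}},$$ the supremum being over $t\in\mathbb{R}$ at which $0<H_{m+n}(t)<1$. The test rejects $\mathcal{H}_0$ for large values of $\mathrm{HC}$. A testing procedure is asymptotically powerful if its risk, i.e. the sum of its probabilities of Type I error (under $\mathcal{H}_0$) and Type II error (under $\mathcal{H}_1$), tends to $0$. For a test that rejects for large values of a statistic $T$, this means that there is a sequence of critical values $(c_n)$ such that the test with rejection region $\{T\ge c_n\}$ has risk tending to $0$. *)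

theory Defs
  imports "HOL-Probability.Probability" "HOL-Library.Landau_Symbols"
begin

definition gen_gauss_const :: "real \<Rightarrow> real" where
  "gen_gauss_const \<gamma> = (LINT x|lborel. exp (- (\<bar>x\<bar> powr \<gamma> / \<gamma>)))"

definition gen_gauss :: "real \<Rightarrow> real measure" where
  "gen_gauss \<gamma> =
     density lborel (\<lambda>x. ennreal (exp (- (\<bar>x\<bar> powr \<gamma> / \<gamma>)) / gen_gauss_const \<gamma>))"

text \<open>The law with distribution function \<open>(1 - \<epsilon>) F + \<epsilon> F(\<cdot> - \<mu>)\<close>, where \<open>F\<close> is the
  distribution function of \<open>M\<close>.\<close>

definition contaminated :: "real measure \<Rightarrow> real \<Rightarrow> real \<Rightarrow> real measure" where
  "contaminated M \<epsilon> \<mu> = interval_measure (\<lambda>t. (1 - \<epsilon>) * cdf M t + \<epsilon> * cdf M (t - \<mu>))"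

lemma contaminated_cdf:
  assumes "real_distribution M" "0 \<le> \<epsilon>" "\<epsilon> \<le> 1"
  shows "real_distribution (contaminated M \<epsilon> \<mu>)"
    and "cdf (contaminated M \<epsilon> \<mu>) t = (1 - \<epsilon>) * cdf M t + \<epsilon> * cdf M (t - \<mu>)"
proof -
  interpret real_distribution M by fact
  let ?G = "\<lambda>t. (1 - \<epsilon>) * cdf M t + \<epsilon> * cdf M (t - \<mu>)"
  have mono: "?G x \<le> ?G y" if "x \<le> y" for x y
    using that assms by (intro add_mono mult_left_mono cdf_nondecreasing) auto
  have rc: "continuous (at_right a) ?G" for a
  proof -
    have "filterlim (\<lambda>t. t - \<mu>) (at_right (a - \<mu>)) (at_right a)"
      unfolding filterlim_at
      by (auto intro!: tendsto_eq_intros simp: eventually_at_filter)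
    then have "((\<lambda>t. cdf M (t - \<mu>)) \<longlongrightarrow> cdf M (a - \<mu>)) (at_right a)"
      using cdf_is_right_cont[of "a - \<mu>"] unfolding continuous_within
      by (rule filterlim_compose[rotated])
    then show ?thesis
      using cdf_is_right_cont[of a] unfolding continuous_within
      by (intro tendsto_intros)
  qed
  have bot: "(?G \<longlongrightarrow> 0) at_bot"
  proof -
    have "((\<lambda>t. cdf M (t - \<mu>)) \<longlongrightarrow> 0) at_bot"
      by (rule filterlim_compose[OF cdf_lim_at_bot])
         (simp add: filterlim_at_bot eventually_at_bot_linorder, meson diff_le_eq)
    then show ?thesis
      using cdf_lim_at_bot by (auto intro!: tendsto_eq_intros)
  qed
  have top: "(?G \<longlongrightarrow> 1) at_top"
  proof -
    have "((\<lambda>t. cdf M (t - \<mu>)) \<longlongrightarrow> 1) at_top"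
      by (rule filterlim_compose[OF cdf_lim_at_top_prob])
         (use filterlim_tendsto_add_at_top[OF tendsto_const filterlim_ident, of "-\<mu>"] in simp)
    then show ?thesis
      using cdf_lim_at_top_prob by (auto intro!: tendsto_eq_intros)
  qed
  show "real_distribution (contaminated M \<epsilon> \<mu>)"
    unfolding contaminated_def by (rule real_distribution_interval_measure[OF mono rc bot top])
  show "cdf (contaminated M \<epsilon> \<mu>) t = ?G t"
    unfolding contaminated_def by (subst cdf_interval_measure[OF mono rc bot]) auto
qed

text \<open>A pair of independent iid samples, of size \<open>m\<close> from \<open>F\<close> and of size \<open>n\<close> from \<open>G\<close>,
  each indexed from \<open>0\<close>.\<close>

definition two_sample :: "nat \<Rightarrow> nat \<Rightarrow> real measure \<Rightarrow> real measure
    \<Rightarrow> ((nat \<Rightarrow> real) \<times> (nat \<Rightarrow> real)) measure" where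
  "two_sample m n F G = (\<Pi>\<^sub>M i\<in>{..<m}. F) \<Otimes>\<^sub>M (\<Pi>\<^sub>M j\<in>{..<n}. G)"

definition ecdf :: "nat \<Rightarrow> (nat \<Rightarrow> real) \<Rightarrow> real \<Rightarrow> real" where
  "ecdf k x t = real (card {i\<in>{..<k}. x i \<le> t}) / real k"

definition pooled_ecdf :: "nat \<Rightarrow> nat \<Rightarrow> (nat \<Rightarrow> real) \<times> (nat \<Rightarrow> real) \<Rightarrow> real \<Rightarrow> real" where
  "pooled_ecdf m n = (\<lambda>(x, y) t. (real m * ecdf m x t + real n * ecdf n y t) / real (m + n))"

text \<open>The supremum ranges over finitely many values, so it is always that of a bounded set; the
  set is empty only if all \<open>m + n\<close> observations coincide, which has probability zero
  under continuous distributions once \<open>m + n \<ge> 2\<close>.\<close>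

definition HC :: "nat \<Rightarrow> nat \<Rightarrow> (nat \<Rightarrow> real) \<times> (nat \<Rightarrow> real) \<Rightarrow> real" where
  "HC m n = (\<lambda>(x, y).
     (\<Squnion>t\<in>{t. 0 < pooled_ecdf m n (x, y) t \<and> pooled_ecdf m n (x, y) t < 1}.
        sqrt (real m * real n / real (m + n)) *
        ((ecdf m x t - ecdf n y t) /
          sqrt (pooled_ecdf m n (x, y) t * (1 - pooled_ecdf m n (x, y) t)))))"

text \<open>Risk of the test that rejects on \<open>R\<close>: \<open>P\<close> is the law of the data under the null
  hypothesis, \<open>Q\<close> under the alternative.\<close>

definition risk :: "'a measure \<Rightarrow> 'a measure \<Rightarrow> ('a \<Rightarrow> bool) \<Rightarrow> real" where
  "risk P Q R = measure P {\<omega> \<in> space P. R \<omega>} + measure Q {\<omega> \<in> space Q. \<not> R \<omega>}"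

definition asymptotically_powerful ::
    "(nat \<Rightarrow> 'a measure) \<Rightarrow> (nat \<Rightarrow> 'a measure) \<Rightarrow> (nat \<Rightarrow> 'a \<Rightarrow> real) \<Rightarrow> bool" where
  "asymptotically_powerful P Q T \<longleftrightarrow>
     (\<exists>c :: nat \<Rightarrow> real. (\<lambda>n. risk (P n) (Q n) (\<lambda>\<omega>. c n \<le> T n \<omega>)) \<longlonglongrightarrow> 0)"

definition HC_asymptotically_powerful ::
    "(nat \<Rightarrow> nat) \<Rightarrow> real measure \<Rightarrow> (nat \<Rightarrow> real measure) \<Rightarrow> bool" where
  "HC_asymptotically_powerful m F G \<longleftrightarrow>
     asymptotically_powerful
       (\<lambda>n. two_sample (m n) n F F) (\<lambda>n. two_sample (m n) n F (G n)) (\<lambda>n. HC (m n) n)"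

text \<open>For \<open>\<gamma> > 1\<close> the two branches agree at \<open>\<beta> = 1 - 2 powr (- \<gamma> / (\<gamma> - 1))\<close>
  (lemma \<open>rho_star_branches_agree\<close>), so the value there is the common one.\<close>

definition rho_star :: "real \<Rightarrow> real \<Rightarrow> real" where
  "rho_star \<gamma> \<beta> =
     (if \<gamma> \<le> 1 then 2 * \<beta> - 1
      else if \<beta> < 1 - 2 powr (- (\<gamma> / (\<gamma> - 1)))
           then (2 powr (1 / (\<gamma> - 1)) - 1) powr (\<gamma> - 1) * (\<beta> - 1 / 2)
           else (1 - (1 - \<beta>) powr (1 / \<gamma>)) powr \<gamma>)"

lemma rho_star_branches_agree:
  fixes \<gamma> \<beta> :: real
  assumes "1 < \<gamma>" and "\<beta> = 1 - 2 powr (- (\<gamma> / (\<gamma> - 1)))"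
  shows "(2 powr (1 / (\<gamma> - 1)) - 1) powr (\<gamma> - 1) * (\<beta> - 1 / 2)
       = (1 - (1 - \<beta>) powr (1 / \<gamma>)) powr \<gamma>"
proof -
  define a :: real where "a = (2 :: real) powr (1 / (\<gamma> - 1))"
  have a1: "a > 1" unfolding a_def using assms(1) by (intro gr_one_powr) auto
  have ag: "a powr (\<gamma> - 1) = 2" unfolding a_def using assms(1) by (simp add: powr_powr)
  have ag': "a powr \<gamma> = 2 * a"
    using powr_add[of a "\<gamma> - 1" 1] ag a1 by simp
  have b: "1 - \<beta> = a powr (- \<gamma>)"
    unfolding a_def assms(2) by (simp add: powr_powr)
  have b': "1 - \<beta> = 1 / (2 * a)"
    using b ag' by (simp add: powr_minus_divide)
  have r: "(1 - \<beta>) powr (1 / \<gamma>) = 1 / a"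
    unfolding b powr_powr using assms(1) a1 by (simp add: powr_minus_divide)
  have "1 - 1 / a = (a - 1) / a" using a1 by (simp add: field_simps)
  then have "(1 - 1 / a) powr \<gamma> = (a - 1) powr \<gamma> / (2 * a)"
    using a1 ag' by (simp add: powr_divide)
  also have "(a - 1) powr \<gamma> = (a - 1) powr (\<gamma> - 1) * (a - 1)"
    using powr_add[of "a - 1" "\<gamma> - 1" 1] a1 by simp
  also have "(a - 1) powr (\<gamma> - 1) * (a - 1) / (2 * a)
      = (a - 1) powr (\<gamma> - 1) * ((a - 1) / (2 * a))" by simp
  also have "(a - 1) / (2 * a) = \<beta> - 1 / 2"
    using b' a1 by (simp add: field_simps)
  finally show ?thesis unfolding r a_def[symmetric] by simp
qed

end

theory Submission
  imports Defs "HOL-Real_Asymp.Real_Asymp"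
begin

text \<open>The main obstacle is the random normaliser. Concentration is governed by the variance
  under \<open>F\<close>, but the statistic is divided by the pooled empirical variance, and far out
  in the tails the expected number of observations drops below one. Two devices handle this. Count
  variances are always increased by 1, which keeps the Chernoff parameter at most 1 and absorbs the
  rounding to the grid. And \<open>pooled_ecdf\<close> only takes multiples of \<open>1 / N\<close>,
  so strictly inside (0, 1) the pooled count variance is at least 1/2; a self-bounding quadratic
  inequality then bounds the variance under \<open>F\<close> by the pooled one. The resulting tails
  are only exponential, not Gaussian, in \<open>x\<close>. This suffices: \<open>x\<close> of order
  \<open>ln n\<close> pays for the union over the grid, and the loss is polylogarithmic against a
  separation by a positive power of \<open>n\<close>. Constants and logarithms therefore never
  matter, and the remaining analysis compares exponents of \<open>n\<close>.\<close>

text \<open>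
  The test with critical value \<open>n powr (\<delta> / 2)\<close> works for a small \<open>\<delta> > 0\<close>. Chernoff's bound with
  Bernstein-type variance scaling, applied at the \<open>j / N\<close>-quantiles of \<open>F\<close> (where \<open>N = m + n\<close>) and
  extended to all points by monotonicity, shows that under the null hypothesis the statistic is at most
  polylogarithmic with probability \<open>1 - O(1 / n)\<close>. Under the alternative a single threshold \<open>t\<close>
  suffices: if \<open>n (F t - G t)\<^sup>2 \<ge> n powr (2 * \<delta>) * (1 - G t)\<close>, the statistic at \<open>t\<close> exceeds the
  critical value with probability \<open>1 - O(1 / n)\<close>. In the dense regime \<open>t = 0\<close> will do; in the sparse
  regime \<open>t = a (\<gamma> ln n) powr (1 / \<gamma>)\<close>, where \<open>a\<close> is chosen by comparing exponents of \<open>n\<close>.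
\<close>

section \<open>Concentration of the empirical distribution function\<close>

text \<open>For a negative argument \<open>- z\<close>, the product of \<open>1 - z + z^2\<close>
  with the quadratic Taylor polynomial of \<open>exp z\<close> exceeds 1 by a polynomial with
  nonnegative coefficients.\<close>

lemma exp_le_quadratic:
  fixes y :: real
  assumes "\<bar>y\<bar> \<le> 1"
  shows "exp y \<le> 1 + y + y\<^sup>2"
proof (cases "0 \<le> y")
  case True
  then show ?thesis using exp_bound[of y] assms by simp
next
  case False
  define z where "z = - y"
  have z: "0 \<le> z" using False by (simp add: z_def)
  have "0 \<le> z\<^sup>2 / 2 + z ^ 3 / 2 + z ^ 4 / 2" using z by simp
  also have "\<dots> = (1 - z + z\<^sup>2) * (1 + z + z\<^sup>2 / 2) - 1"
    by (simp add: field_simps power_numeral_reduce)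
  finally have *: "1 \<le> (1 - z + z\<^sup>2) * (1 + z + z\<^sup>2 / 2)" by simp
  have q: "0 \<le> 1 - z + z\<^sup>2"
    using sum_power2_ge_zero[of "z - 1 / 2" 0] by (simp add: power2_eq_square algebra_simps)
  have "1 \<le> (1 - z + z\<^sup>2) * exp z"
    by (rule order_trans[OF * mult_left_mono[OF exp_lower_Taylor_quadratic[OF z] q]])
  then have "exp (- z) \<le> 1 - z + z\<^sup>2" by (simp add: exp_minus field_simps)
  then show ?thesis by (simp add: z_def)
qed

text \<open>Chernoff's method with the fixed parameter \<open>l = 1 / sqrt (1 + k * w)\<close>. The
  1 under the root forces \<open>l \<le> 1\<close>, so \<open>exp_le_quadratic\<close> applies to
  \<open>l * f y\<close>. The linear term has mean zero, and the moment generating function of the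
  whole sum stays below \<open>exp 1\<close>.\<close>

lemma iid_sum_upper_tail:
  fixes f :: "'a \<Rightarrow> real"
  assumes "prob_space M" and [measurable]: "f \<in> borel_measurable M"
    and bd: "\<And>y. y \<in> space M \<Longrightarrow> \<bar>f y\<bar> \<le> 1"
    and mean: "(\<integral>y. f y \<partial>M) = 0" and var: "(\<integral>y. (f y)\<^sup>2 \<partial>M) = w"
  shows "measure (\<Pi>\<^sub>M i\<in>{..<k}. M)
      {\<omega> \<in> space (\<Pi>\<^sub>M i\<in>{..<k}. M). x * sqrt (1 + real k * w) \<le> (\<Sum>i<k. f (\<omega> i))} \<le> exp (1 - x)"
proof -
  interpret prob_space M by fact
  interpret P: product_prob_space "\<lambda>_. M" "{..<k}" by unfold_locales
  let ?P = "\<Pi>\<^sub>M i\<in>{..<k}. M"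
  have w: "0 \<le> w" unfolding var[symmetric] by simp
  define s where "s = sqrt (1 + real k * w)"
  define l where "l = 1 / s"
  have s1: "1 \<le> s" unfolding s_def using w by simp
  have l: "0 < l" "l \<le> 1" using s1 by (auto simp: l_def)
  have s2: "s\<^sup>2 = 1 + real k * w" unfolding s_def using w by simp
  have int_f: "integrable M f"
    by (rule integrable_const_bound[of _ 1]) (use bd in auto)
  have int_f2: "integrable M (\<lambda>y. (f y)\<^sup>2)"
    by (rule integrable_const_bound[of _ 1]) (use bd in \<open>auto intro!: abs_square_le_1[THEN iffD2]\<close>)
  have int_e: "integrable M (\<lambda>y. exp (l * f y))"
  proof (rule integrable_const_bound[of _ "exp 1"])
    have "l * f y \<le> 1" if "y \<in> space M" for y
      using mult_left_le[of "f y" l] bd[OF that] l by (smt (verit) mult_left_le)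
    then show "AE y in M. norm (exp (l * f y)) \<le> exp 1" by auto
  qed simp
  have mgf: "(\<integral>y. exp (l * f y) \<partial>M) \<le> exp (l\<^sup>2 * w)"
  proof -
    have "(\<integral>y. exp (l * f y) \<partial>M) \<le> (\<integral>y. 1 + l * f y + l\<^sup>2 * (f y)\<^sup>2 \<partial>M)"
    proof (rule integral_mono[OF int_e])
      show "integrable M (\<lambda>y. 1 + l * f y + l\<^sup>2 * (f y)\<^sup>2)"
        using int_f int_f2 by simp
      fix y assume "y \<in> space M"
      then have "\<bar>l * f y\<bar> \<le> 1" using bd[of y] l by (simp add: abs_mult mult_le_one)
      from exp_le_quadratic[OF this] show "exp (l * f y) \<le> 1 + l * f y + l\<^sup>2 * (f y)\<^sup>2"
        by (simp add: power_mult_distrib)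
    qed
    also have "\<dots> = 1 + l\<^sup>2 * w"
      using int_f int_f2 by (simp add: mean var prob_space)
    also have "\<dots> \<le> exp (l\<^sup>2 * w)" by (rule exp_ge_add_one_self)
    finally show ?thesis .
  qed
  have int_p: "integrable ?P (\<lambda>\<omega>. \<Prod>i<k. exp (l * f (\<omega> i)))"
    by (rule P.product_integrable_prod) (auto simp: int_e)
  have "measure ?P {\<omega> \<in> space ?P. x * s \<le> (\<Sum>i<k. f (\<omega> i))}
      = measure ?P {\<omega> \<in> space ?P. exp x \<le> (\<Prod>i<k. exp (l * f (\<omega> i)))}"
  proof -
    have "x * s \<le> S \<longleftrightarrow> x \<le> l * S" for S using s1 by (simp add: l_def field_simps)
    then show ?thesis by (simp add: exp_sum[symmetric] sum_distrib_left[symmetric])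
  qed
  also have "\<dots> \<le> (\<integral>\<omega>. (\<Prod>i<k. exp (l * f (\<omega> i))) \<partial>?P) / exp x"
    by (rule integral_Markov_inequality_measure[OF int_p, of "space ?P"]) (auto intro!: prod_nonneg)
  also have "(\<integral>\<omega>. (\<Prod>i<k. exp (l * f (\<omega> i))) \<partial>?P) = (\<integral>y. exp (l * f y) \<partial>M) ^ k"
    by (subst P.product_integral_prod) (auto simp: int_e)
  also have "\<dots> \<le> exp (l\<^sup>2 * w) ^ k"
    by (rule power_mono[OF mgf]) simp
  also have "\<dots> = exp (l\<^sup>2 * (real k * w))" by (simp add: exp_of_nat_mult[symmetric] mult_ac)
  \<comment> \<open>The exponent is \<open>k * w / (1 + k * w)\<close>.\<close>
  also have "\<dots> \<le> exp 1"
  proof -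
    have "0 \<le> real k * w" using w by simp
    then show ?thesis using s2 by (simp add: l_def power_divide)
  qed
  finally show ?thesis by (simp add: s_def exp_diff divide_right_mono)
qed

lemma count_le_eq_sum_indicator:
  "real k * ecdf k \<omega> t = (\<Sum>i<k. indicator {..t} (\<omega> i))"
proof -
  have "(\<Sum>i<k. indicator {..t} (\<omega> i) :: real) = (\<Sum>i<k. if \<omega> i \<le> t then 1 else 0)"
    by (intro sum.cong) (auto simp: indicator_def)
  also have "\<dots> = real (card {i \<in> {..<k}. \<omega> i \<le> t})"
    by (simp add: sum.If_cases Int_def)
  finally show ?thesis by (cases "k = 0") (auto simp: ecdf_def)
qed

text \<open>The bad event for one sample at one point, in counts rather than frequencies so that
  samples of both sizes can be added. The threshold is the one of \<open>iid_sum_upper_tail\<close>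
  for a centred indicator.\<close>

definition deviant :: "nat \<Rightarrow> real measure \<Rightarrow> real \<Rightarrow> real \<Rightarrow> (nat \<Rightarrow> real) set" where
  "deviant k F x t = {\<omega> \<in> space (\<Pi>\<^sub>M i\<in>{..<k}. F).
     x * sqrt (1 + real k * (cdf F t * (1 - cdf F t))) \<le> \<bar>real k * ecdf k \<omega> t - real k * cdf F t\<bar>}"

lemma sets_deviant:
  assumes "real_distribution F"
  shows "deviant k F x t \<in> sets (\<Pi>\<^sub>M i\<in>{..<k}. F)"
proof -
  interpret real_distribution F by fact
  show ?thesis unfolding deviant_def count_le_eq_sum_indicator by measurable
qed

lemma measure_deviant_le:
  assumes "real_distribution F"
  shows "measure (\<Pi>\<^sub>M i\<in>{..<k}. F) (deviant k F x t) \<le> 2 * exp (1 - x)"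
proof -
  interpret real_distribution F by fact
  interpret P: product_prob_space "\<lambda>_. F" "{..<k}" by unfold_locales
  let ?P = "\<Pi>\<^sub>M i\<in>{..<k}. F"
  define p where "p = cdf F t"
  have p: "0 \<le> p" "p \<le> 1" unfolding p_def by (auto simp: cdf_nonneg cdf_bounded_prob)
  define s where "s = sqrt (1 + real k * (p * (1 - p)))"
  \<comment> \<open>The sign \<open>c\<close> treats the upper and the lower tail together.\<close>
  have tail: "measure ?P {\<omega> \<in> space ?P. x * s \<le> (\<Sum>i<k. c * (indicator {..t} (\<omega> i) - p))}
      \<le> exp (1 - x)" if c: "c = 1 \<or> c = -1" for c :: real
    unfolding s_def
  proof (rule iid_sum_upper_tail)
    have int: "integrable F (indicator {..t} :: real \<Rightarrow> real)"
      by (simp add: integrable_indicator_iff less_top[symmetric])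
    have U: "prob UNIV = 1" using prob_space by simp
    show "(\<integral>y. c * (indicator {..t} y - p) \<partial>F) = 0"
      using int by (simp add: p_def cdf_def U)
    have "(\<lambda>y. (c * (indicator {..t} y - p))\<^sup>2) = (\<lambda>y. (1 - 2 * p) * indicator {..t} y + p\<^sup>2)"
      using c by (auto simp: indicator_def power2_eq_square algebra_simps)
    then show "(\<integral>y. (c * (indicator {..t} y - p))\<^sup>2 \<partial>F) = p * (1 - p)"
      using int by (simp add: p_def cdf_def U power2_eq_square algebra_simps)
  qed (use c p in \<open>auto simp: indicator_def prob_space_axioms\<close>)
  have sum_eq: "(\<Sum>i<k. indicator {..t} (\<omega> i) - p) = real k * ecdf k \<omega> t - real k * p" for \<omega>
    by (simp add: count_le_eq_sum_indicator sum_subtractf)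
  have "deviant k F x t = {\<omega> \<in> space ?P. x * s \<le> (\<Sum>i<k. 1 * (indicator {..t} (\<omega> i) - p))}
      \<union> {\<omega> \<in> space ?P. x * s \<le> (\<Sum>i<k. (-1) * (indicator {..t} (\<omega> i) - p))}"
    unfolding deviant_def p_def[symmetric] s_def[symmetric] sum_distrib_left[symmetric] sum_eq
    by (auto simp: abs_if)
  also have "measure ?P \<dots> \<le> exp (1 - x) + exp (1 - x)"
    by (rule order_trans[OF measure_Un_le add_mono[OF tail tail]]) (auto, measurable)
  finally show ?thesis by simp
qed

section \<open>The higher criticism statistic\<close>

lemma ecdf_bounds: "0 \<le> ecdf k \<omega> t" "ecdf k \<omega> t \<le> 1"
proof -
  have "card {i \<in> {..<k}. \<omega> i \<le> t} \<le> card {..<k}" by (rule card_mono) auto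
  then show "ecdf k \<omega> t \<le> 1" by (cases "k = 0") (auto simp: ecdf_def)
qed (simp add: ecdf_def)

lemma ecdf_mono: "s \<le> t \<Longrightarrow> ecdf k \<omega> s \<le> ecdf k \<omega> t"
  unfolding ecdf_def by (intro divide_right_mono of_nat_mono card_mono) auto

lemma finite_range_ecdf: "finite (range (ecdf k \<omega>))"
proof (rule finite_subset)
  have "card {i \<in> {..<k}. \<omega> i \<le> t} \<le> card {..<k}" for t by (rule card_mono) auto
  then show "range (ecdf k \<omega>) \<subseteq> (\<lambda>i. real i / real k) ` {..k}"
    by (auto simp: ecdf_def)
qed simp

lemma HC_ge:
  assumes "0 < pooled_ecdf m n (x, y) t" "pooled_ecdf m n (x, y) t < 1"
  shows "sqrt (real m * real n / real (m + n)) * ((ecdf m x t - ecdf n y t) /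
      sqrt (pooled_ecdf m n (x, y) t * (1 - pooled_ecdf m n (x, y) t))) \<le> HC m n (x, y)"
proof -
  \<comment> \<open>The term at \<open>t\<close> depends on \<open>t\<close> only through the two
    empirical values, which range over finite sets; this bounds the supremum.\<close>
  define \<Phi> where "\<Phi> = (\<lambda>(a, b). let h = (real m * a + real n * b) / real (m + n) in
      sqrt (real m * real n / real (m + n)) * ((a - b) / sqrt (h * (1 - h))))"
  have eq: "sqrt (real m * real n / real (m + n)) * ((ecdf m x t - ecdf n y t) /
      sqrt (pooled_ecdf m n (x, y) t * (1 - pooled_ecdf m n (x, y) t)))
      = \<Phi> (ecdf m x t, ecdf n y t)" for t
    by (simp add: \<Phi>_def pooled_ecdf_def Let_def)
  have "finite (\<Phi> ` (range (ecdf m x) \<times> range (ecdf n y)))"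
    by (intro finite_imageI finite_cartesian_product finite_range_ecdf)
  then have "bdd_above ((\<lambda>t. \<Phi> (ecdf m x t, ecdf n y t)) `
      {t. 0 < pooled_ecdf m n (x, y) t \<and> pooled_ecdf m n (x, y) t < 1})"
    by (intro bdd_above_finite) (erule finite_subset[rotated], auto)
  then show ?thesis
    unfolding HC_def prod.case eq by (rule cSUP_upper[rotated]) (use assms in auto)
qed

text \<open>The premise on \<open>Sup {}\<close> covers the samples whose observations all coincide.\<close>

lemma HC_le:
  assumes "\<And>t. 0 < pooled_ecdf m n (x, y) t \<Longrightarrow> pooled_ecdf m n (x, y) t < 1 \<Longrightarrow>
      sqrt (real m * real n / real (m + n)) * ((ecdf m x t - ecdf n y t) /
      sqrt (pooled_ecdf m n (x, y) t * (1 - pooled_ecdf m n (x, y) t))) \<le> C"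
    and "Sup {} \<le> C"
  shows "HC m n (x, y) \<le> C"
proof (cases "{t. 0 < pooled_ecdf m n (x, y) t \<and> pooled_ecdf m n (x, y) t < 1} = {}")
  case True
  then show ?thesis unfolding HC_def prod.case True using assms(2) by simp
next
  case False
  then show ?thesis unfolding HC_def prod.case by (rule cSUP_least) (use assms(1) in auto)
qed

section \<open>The null hypothesis: deterministic bounds and the tail of the statistic\<close>

text \<open>The map \<open>u * (1 - u)\<close> is 1-Lipschitz on the unit interval, so a shift by
  \<open>1 / N\<close> changes the count variance by at most 1, which the summand 1 absorbs.\<close>

lemma sqrt_variance_shift:
  fixes u v N k :: real
  assumes "0 \<le> u" "u \<le> 1" "0 \<le> v" "v \<le> 1" "0 < N" "\<bar>v - u\<bar> \<le> 1 / N" "0 \<le> k" "k \<le> N"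
  shows "sqrt (1 + k * (v * (1 - v))) \<le> 2 * sqrt (1 + N * (u * (1 - u)))"
proof (rule real_le_lsqrt)
  have "v * (1 - v) - u * (1 - u) = (v - u) * (1 - u - v)" by (simp add: algebra_simps)
  also have "\<dots> \<le> \<bar>v - u\<bar> * \<bar>1 - u - v\<bar>" by (metis abs_ge_self abs_mult)
  also have "\<dots> \<le> \<bar>v - u\<bar>" using assms by (intro mult_left_le) auto
  also have "\<dots> \<le> 1 / N" by fact
  finally have "v * (1 - v) \<le> u * (1 - u) + 1 / N" by simp
  then have "N * (v * (1 - v)) \<le> N * (u * (1 - u) + 1 / N)"
    using assms by (intro mult_left_mono) auto
  also have "\<dots> = N * (u * (1 - u)) + 1" using assms by (simp add: algebra_simps)
  finally have 1: "N * (v * (1 - v)) \<le> N * (u * (1 - u)) + 1" .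
  have 2: "k * (v * (1 - v)) \<le> N * (v * (1 - v))" using assms by (intro mult_right_mono) auto
  have 3: "0 \<le> N * (u * (1 - u))" using assms by simp
  show "1 + k * (v * (1 - v)) \<le> (2 * sqrt (1 + N * (u * (1 - u))))\<^sup>2"
    using 1 2 3 by (simp add: power_mult_distrib)
qed (use assms in auto)

text \<open>Here \<open>c\<close> is a count and \<open>q j\<close> a quantile. By monotonicity
  \<open>c t\<close> lies between its values at neighbouring quantiles, and between these
  \<open>k * F\<close> moves by at most \<open>k / N \<le> 1\<close>. Beyond the outermost quantiles
  the trivial bounds 0 and \<open>k\<close> on \<open>c\<close> do.\<close>

lemma deviation_from_grid:
  fixes F c :: "real \<Rightarrow> real"
  assumes F: "mono F" "\<And>t. 0 \<le> F t" "\<And>t. F t \<le> 1"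
    and c: "mono c" "\<And>t. 0 \<le> c t" "\<And>t. c t \<le> k"
    and k: "0 \<le> k" "k \<le> real N" "0 < N" and x: "0 \<le> x"
    and q: "\<And>j. j \<in> {1..<N} \<Longrightarrow> F (q j) = real j / real N"
    and dev: "\<And>j. j \<in> {1..<N} \<Longrightarrow>
      \<bar>c (q j) - k * F (q j)\<bar> \<le> x * sqrt (1 + k * (F (q j) * (1 - F (q j))))"
  shows "\<bar>c t - k * F t\<bar> \<le> 2 * (1 + x) * sqrt (1 + real N * (F t * (1 - F t)))"
proof -
  define u where "u = F t"
  define y where "y = sqrt (1 + real N * (u * (1 - u)))"
  have u: "0 \<le> u" "u \<le> 1" using F by (auto simp: u_def)
  have y: "1 \<le> y" unfolding y_def using u by simp
  have slack: "1 + x * (2 * y) \<le> 2 * (1 + x) * y"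
    using y by (simp add: algebra_simps)
  have kd: "k * d \<le> 1" if "d \<le> 1 / real N" for d
  proof -
    have "k * d \<le> k * (1 / real N)" using that k by (intro mult_left_mono) auto
    also have "\<dots> \<le> 1" using k by simp
    finally show ?thesis .
  qed
  have near: "\<bar>c (q j) - k * F (q j)\<bar> \<le> x * (2 * y)"
    if j: "j \<in> {1..<N}" and "\<bar>real j / real N - u\<bar> \<le> 1 / real N" for j
    using order_trans[OF dev[OF j] mult_left_mono[OF
      sqrt_variance_shift[of u "F (q j)" "real N" k] x]] that F q[OF j] u k
    by (simp add: y_def)
  have "c t - k * u \<le> 1 + x * (2 * y)"
  proof -
    \<comment> \<open>The first grid level strictly above \<open>u\<close>; strictness is what turns
      \<open>F t < F (q j)\<close> into \<open>t \<le> q j\<close>.\<close>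
    define j where "j = nat (\<lfloor>u * real N\<rfloor> + 1)"
    have j: "u * real N < real j" "real j \<le> u * real N + 1" "1 \<le> j"
      unfolding j_def using u by (auto simp: nat_add_distrib) linarith+
    have d1: "u < real j / real N" using j k by (simp add: less_divide_eq)
    have d2: "real j / real N - u \<le> 1 / real N"
      using divide_right_mono[OF j(2), of "real N"] k by (simp add: add_divide_distrib)
    note d = d1 d2
    show ?thesis
    proof (cases "j < N")
      case True
      then have jN: "j \<in> {1..<N}" using j by simp
      have "t \<le> q j"
        using d q[OF jN] monoD[OF F(1), of "q j" t] by (force simp: u_def)
      then have "c t \<le> c (q j)" by (rule monoD[OF c(1)])
      also have "\<dots> \<le> k * (real j / real N) + x * (2 * y)"
        using near[OF jN] d q[OF jN] by auto
      finally show ?thesis using kd[OF d(2)] by (simp add: right_diff_distrib)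
    next
      case False
      then have "real N \<le> real j" by simp
      then have "1 - u \<le> 1 / real N" using j k by (simp add: field_simps)
      from kd[OF this] have "k - k * u \<le> 1" by (simp add: right_diff_distrib)
      moreover have "0 \<le> x * (2 * y)" using x y by simp
      ultimately show ?thesis using c(3)[of t] by simp
    qed
  qed
  moreover have "k * u - c t \<le> 1 + x * (2 * y)"
  proof (cases "1 < \<lceil>u * real N\<rceil>")
    case True
    \<comment> \<open>The last grid level strictly below \<open>u\<close>; the case assumption makes
      it at least 1.\<close>
    define j where "j = nat (\<lceil>u * real N\<rceil> - 1)"
    have j: "real j < u * real N" "u * real N \<le> real j + 1" "1 \<le> j"
      unfolding j_def using True by (auto simp: nat_diff_distrib) linarith+
    have d1: "real j / real N < u" using j k by (simp add: divide_less_eq)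
    have d2: "u - real j / real N \<le> 1 / real N"
      using divide_right_mono[OF j(2), of "real N"] k by (simp add: add_divide_distrib)
    note d = d1 d2
    have "u * real N \<le> real N" using u k by (simp add: mult_left_le_one_le)
    then have "real j < real N" using j by simp
    then have jN: "j \<in> {1..<N}" using j by simp
    have "q j \<le> t"
      using d q[OF jN] monoD[OF F(1), of t "q j"] by (force simp: u_def)
    then have "c (q j) \<le> c t" by (rule monoD[OF c(1)])
    moreover have "k * (real j / real N) - x * (2 * y) \<le> c (q j)"
      using near[OF jN] d q[OF jN] by auto
    ultimately show ?thesis using kd[OF d(2)] by (simp add: right_diff_distrib)
  next
    case False
    then have "u * real N \<le> 1" by linarith
    then have "u \<le> 1 / real N" using k by (simp add: field_simps)
    from kd[OF this] have "k * u \<le> 1" .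
    moreover have "0 \<le> x * (2 * y)" using x y by simp
    ultimately show ?thesis using c(2)[of t] by simp
  qed
  ultimately show ?thesis
    using slack unfolding u_def[symmetric] y_def[symmetric] by linarith
qed

text \<open>Both count deviations are at most a multiple of \<open>y\<close>, the deviation scale
  under \<open>F\<close>, while the statistic is divided by the pooled scale \<open>z\<close>. The
  mean of the pooled count differs from the count itself by at most \<open>B * y\<close>, so the
  variance bound for \<open>y\<close> involves \<open>y\<close> itself and is solved as a quadratic
  inequality.\<close>

lemma normalised_difference_le:
  fixes a b u h x :: real and m n :: nat
  assumes mn: "0 < m" "0 < n" and x: "0 \<le> x" and u: "0 \<le> u" "u \<le> 1"
    and R: "R = 2 * (1 + x) * sqrt (1 + real (m + n) * (u * (1 - u)))"
    and a: "\<bar>real m * a - real m * u\<bar> \<le> R" and b: "\<bar>real n * b - real n * u\<bar> \<le> R"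
    and h: "h = (real m * a + real n * b) / real (m + n)"
    and h1: "1 / real (m + n) \<le> h" "h \<le> 1 - 1 / real (m + n)"
  shows "sqrt (real m * real n / real (m + n)) * ((a - b) / sqrt (h * (1 - h)))
    \<le> 24 * (1 + x)\<^sup>2 * (real (m + n) / sqrt (real m * real n))"
proof -
  define N where "N = real (m + n)"
  define B where "B = 4 * (1 + x)"
  define y where "y = sqrt (1 + N * (u * (1 - u)))"
  define V where "V = N * (h * (1 - h))"
  have N: "2 \<le> N" using mn by (simp add: N_def)
  have B: "4 \<le> B" using x by (simp add: B_def)
  have R': "R = B / 2 * y" by (simp add: R B_def y_def N_def)
  have "0 < 1 / N" using N by simp
  then have hb: "0 < h" "h < 1" using h1[folded N_def] by linarith+
  \<comment> \<open>By concavity \<open>h * (1 - h)\<close> is smallest at the ends of the permitted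
    range, where \<open>V = 1 - 1 / N\<close> with \<open>N \<ge> 2\<close>.\<close>
  have V: "1 / 2 \<le> V"
  proof -
    have "(h - 1 / N) * (1 - 1 / N - h) \<ge> 0" using h1 by (simp add: N_def)
    then have "(1 / N) * (1 - 1 / N) \<le> h * (1 - h)" by (simp add: algebra_simps)
    then have "N * ((1 / N) * (1 - 1 / N)) \<le> V" unfolding V_def using N by (intro mult_left_mono) auto
    moreover have "N * ((1 / N) * (1 - 1 / N)) = 1 - 1 / N" using N by simp
    moreover have "1 / N \<le> 1 / 2" using N by simp
    ultimately show ?thesis by linarith
  qed
  define z where "z = sqrt V"
  have z2: "z\<^sup>2 = V" using V by (simp add: z_def)
  have z: "1 / 2 \<le> z"
    unfolding z_def by (rule real_le_rsqrt) (use V in \<open>simp add: power2_eq_square\<close>)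
  have y2: "y\<^sup>2 = 1 + N * (u * (1 - u))" unfolding y_def using u N by simp
  have y1: "1 \<le> y" unfolding y_def using u N by simp
  have "N * h = real m * a + real n * b" using N by (simp add: h N_def)
  then have hu: "\<bar>N * h - N * u\<bar> \<le> B * y"
    using abs_le_D1[OF a] abs_le_D2[OF a] abs_le_D1[OF b] abs_le_D2[OF b]
    unfolding abs_le_iff by (simp add: R' N_def algebra_simps)
  have "N * (u * (1 - u)) - V = (N * u - N * h) * (1 - u - h)"
    by (simp add: V_def algebra_simps)
  also have "\<dots> \<le> \<bar>N * u - N * h\<bar> * \<bar>1 - u - h\<bar>" by (metis abs_ge_self abs_mult)
  also have "\<dots> \<le> \<bar>N * u - N * h\<bar>" using u hb by (intro mult_left_le) auto
  also have "\<dots> \<le> B * y" using hu by (simp add: abs_minus_commute)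
  finally have "y\<^sup>2 \<le> 1 + V + B * y" using y2 by simp
  then have yq: "y\<^sup>2 \<le> 3 * z\<^sup>2 + B * y" using V z2 by simp
  \<comment> \<open>Otherwise \<open>y\<close> exceeds both \<open>3 * z\<close> and
    \<open>3 * B / 2\<close>, hence also \<open>z + B\<close>, and
    \<open>y * y \<ge> y * z + B * y\<close> contradicts \<open>yq\<close>.\<close>
  have yle: "y \<le> 3 * B * z"
  proof (rule ccontr)
    assume "\<not> ?thesis"
    then have g: "3 * B * z < y" by simp
    have "3 * z < y"
    proof -
      have "3 * z \<le> 3 * B * z" using B z by simp
      then show ?thesis using g by simp
    qed
    moreover have "3 * B / 2 < y"
    proof -
      have "3 * B * (1 / 2) \<le> 3 * B * z" using B z by (intro mult_left_mono) auto
      then show ?thesis using g by simp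
    qed
    ultimately have "y * y \<ge> y * (z + B)"
      using y1 z B by (intro mult_left_mono) linarith+
    moreover have "3 * z * z < y * z" using \<open>3 * z < y\<close> z by (intro mult_strict_right_mono) auto
    ultimately show False using yq by (simp add: power2_eq_square algebra_simps)
  qed
  define S where "S = sqrt (real m * real n)"
  have S: "0 < S" "S\<^sup>2 = real m * real n" using mn by (auto simp: S_def)
  have "a - b = (real m * a - real m * u) / real m - (real n * b - real n * u) / real n"
    using mn by (simp add: field_simps)
  also have "\<dots> \<le> R / real m + R / real n"
  proof -
    have "(real m * a - real m * u) / real m \<le> R / real m"
      using a by (intro divide_right_mono) auto
    moreover have "- (real n * b - real n * u) / real n \<le> R / real n"
      using b by (intro divide_right_mono) auto
    ultimately show ?thesis unfolding divide_minus_left by linarith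
  qed
  also have "\<dots> = R * N / S\<^sup>2" using mn by (simp add: S N_def field_simps)
  finally have ab: "a - b \<le> R * N / S\<^sup>2" .
  have s: "sqrt (h * (1 - h)) = z / sqrt N"
    using N by (simp add: z_def V_def real_sqrt_mult)
  have "sqrt (real m * real n / N) * ((a - b) / sqrt (h * (1 - h))) = S * (a - b) / z"
    using N z by (simp add: s S_def real_sqrt_divide)
  also have "\<dots> \<le> S * (R * N / S\<^sup>2) / z"
    using ab S z by (intro divide_right_mono mult_left_mono) auto
  also have "\<dots> = (B / 2 * y / z) * (N / S)" using S(1) z by (simp add: R' power2_eq_square mult_ac)
  also have "\<dots> \<le> (B / 2 * (3 * B)) * (N / S)"
    using yle z B N S by (intro mult_right_mono) (auto simp: divide_le_eq)
  \<comment> \<open>The constant 24 is \<open>3 / 2 * 4^2\<close>, from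
    \<open>B = 4 * (1 + x)\<close>.\<close>
  also have "\<dots> = 24 * (1 + x)\<^sup>2 * (N / S)"
    by (rule arg_cong[where f = "\<lambda>c. c * (N / S)"]) (simp add: B_def power2_eq_square algebra_simps)
  finally show ?thesis by (simp add: N_def S_def)
qed

text \<open>\<open>A\<close> may be non-measurable, where \<open>measure\<close> is \<open>0\<close>; hence the measurability of \<open>HC\<close> is never
  an issue.\<close>

lemma measure_le_of_subset:
  assumes "finite_measure M" "A \<subseteq> B" "B \<in> sets M"
  shows "measure M A \<le> measure M B"
proof (cases "A \<in> sets M")
  case True
  interpret finite_measure M by fact
  show ?thesis by (rule finite_measure_mono) (use assms in auto)
qed (simp add: measure_notin_sets)

text \<open>Every bad event below is a union of two cylinders, one for each sample, so only the
  marginal product measures need estimates.\<close>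

lemma two_sample_facts:
  assumes "real_distribution F" "real_distribution G"
  shows prob_space_two_sample: "prob_space (two_sample m n F G)"
    and sets_two_sample_Un: "A \<in> sets (\<Pi>\<^sub>M i\<in>{..<m}. F) \<Longrightarrow> B \<in> sets (\<Pi>\<^sub>M i\<in>{..<n}. G) \<Longrightarrow>
      A \<times> space (\<Pi>\<^sub>M i\<in>{..<n}. G) \<union> space (\<Pi>\<^sub>M i\<in>{..<m}. F) \<times> B \<in> sets (two_sample m n F G)"
    and measure_two_sample_Un: "A \<in> sets (\<Pi>\<^sub>M i\<in>{..<m}. F) \<Longrightarrow> B \<in> sets (\<Pi>\<^sub>M i\<in>{..<n}. G) \<Longrightarrow>
      measure (two_sample m n F G)
        (A \<times> space (\<Pi>\<^sub>M i\<in>{..<n}. G) \<union> space (\<Pi>\<^sub>M i\<in>{..<m}. F) \<times> B)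
      \<le> measure (\<Pi>\<^sub>M i\<in>{..<m}. F) A + measure (\<Pi>\<^sub>M i\<in>{..<n}. G) B"
proof -
  interpret F: real_distribution F by fact
  interpret G: real_distribution G by fact
  interpret PF: product_prob_space "\<lambda>_. F" "{..<m}" by unfold_locales
  interpret PG: product_prob_space "\<lambda>_. G" "{..<n}" by unfold_locales
  let ?P = "\<Pi>\<^sub>M i\<in>{..<m}. F" and ?Q = "\<Pi>\<^sub>M i\<in>{..<n}. G"
  interpret PQ: pair_prob_space ?P ?Q by unfold_locales
  show "prob_space (two_sample m n F G)"
    unfolding two_sample_def by unfold_locales
  assume A: "A \<in> sets ?P" and B: "B \<in> sets ?Q"
  then show "A \<times> space ?Q \<union> space ?P \<times> B \<in> sets (two_sample m n F G)"
    unfolding two_sample_def by simp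
  have "measure (?P \<Otimes>\<^sub>M ?Q) (A \<times> space ?Q \<union> space ?P \<times> B)
      \<le> measure (?P \<Otimes>\<^sub>M ?Q) (A \<times> space ?Q) + measure (?P \<Otimes>\<^sub>M ?Q) (space ?P \<times> B)"
    using A B by (intro measure_Un_le) auto
  also have "\<dots> = measure ?P A + measure ?Q B"
    using A B by (simp add: measure_def PG.P.emeasure_pair_measure_Times enn2real_mult
        PF.P.emeasure_space_1 PG.P.emeasure_space_1)
  finally show "measure (two_sample m n F G) (A \<times> space ?Q \<union> space ?P \<times> B)
      \<le> measure ?P A + measure ?Q B"
    unfolding two_sample_def .
qed

lemma quantile_exists:
  assumes "real_distribution F" "\<And>t. isCont (cdf F) t" "0 < p" "p < 1"
  shows "\<exists>t. cdf F t = p"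
proof -
  interpret real_distribution F by fact
  obtain a where a: "cdf F a < p"
    using order_tendstoD(2)[OF cdf_lim_at_bot assms(3)] eventually_happens by (metis trivial_limit_at_bot_linorder)
  obtain b where b: "p < cdf F b"
    using order_tendstoD(1)[OF cdf_lim_at_top_prob assms(4)] eventually_happens by (metis trivial_limit_at_top_linorder)
  have "a \<le> b" using a b cdf_nondecreasing[of b a] by linarith
  then show ?thesis
    using IVT[of "cdf F" a p b] a b assms(2) by auto
qed

text \<open>Both samples use the same grid of \<open>N - 1\<close> quantiles with
  \<open>N = m + n\<close>, fine enough for either size. The bound is the union over two samples,
  fewer than \<open>N\<close> grid points and two tails. Outside the bad event the deterministic
  lemmas apply at every point.\<close>

lemma HC_null_tail:
  assumes F: "real_distribution F" "\<And>t. isCont (cdf F) t" and mn: "0 < m" "0 < n" and x: "0 \<le> x"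
    and c: "24 * (1 + x)\<^sup>2 * (real (m + n) / sqrt (real m * real n)) < c" "Sup {} < c"
  shows "measure (two_sample m n F F) {\<omega> \<in> space (two_sample m n F F). c \<le> HC m n \<omega>}
    \<le> 4 * real (m + n) * exp (1 - x)"
proof -
  interpret F: real_distribution F by fact
  interpret P: prob_space "two_sample m n F F" by (rule prob_space_two_sample[OF F(1) F(1)])
  define N where "N = m + n"
  have "\<forall>j. \<exists>t. j \<in> {1..<N} \<longrightarrow> cdf F t = real j / real N"
    using quantile_exists[OF F] by simp
  then obtain q where q: "\<And>j. j \<in> {1..<N} \<Longrightarrow> cdf F (q j) = real j / real N"
    by metis
  define A where "A k = (\<Union>j\<in>{1..<N}. deviant k F x (q j))" for k
  have sA: "A k \<in> sets (\<Pi>\<^sub>M i\<in>{..<k}. F)" for k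
    unfolding A_def using sets_deviant[OF F(1)] by auto
  have mA: "measure (\<Pi>\<^sub>M i\<in>{..<k}. F) (A k) \<le> 2 * real N * exp (1 - x)" for k
  proof -
    have "measure (\<Pi>\<^sub>M i\<in>{..<k}. F) (A k)
        \<le> (\<Sum>j\<in>{1..<N}. measure (\<Pi>\<^sub>M i\<in>{..<k}. F) (deviant k F x (q j)))"
      unfolding A_def by (rule measure_UNION_le) (auto intro: sets_deviant[OF F(1)])
    also have "\<dots> \<le> (\<Sum>j\<in>{1..<N}. 2 * exp (1 - x))"
      by (intro sum_mono measure_deviant_le F)
    also have "\<dots> \<le> 2 * real N * exp (1 - x)" by (simp add: mult_right_mono)
    finally show ?thesis .
  qed
  let ?E = "A m \<times> space (\<Pi>\<^sub>M i\<in>{..<n}. F) \<union> space (\<Pi>\<^sub>M i\<in>{..<m}. F) \<times> A n"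
  have "{\<omega> \<in> space (two_sample m n F F). c \<le> HC m n \<omega>} \<subseteq> ?E"
  proof (rule subsetI, rule ccontr)
    fix \<omega> assume \<omega>: "\<omega> \<in> {\<omega> \<in> space (two_sample m n F F). c \<le> HC m n \<omega>}" and nE: "\<omega> \<notin> ?E"
    obtain X Y where XY: "\<omega> = (X, Y)" by (cases \<omega>)
    have sp: "X \<in> space (\<Pi>\<^sub>M i\<in>{..<m}. F)" "Y \<in> space (\<Pi>\<^sub>M i\<in>{..<n}. F)"
      using \<omega> by (auto simp: XY two_sample_def space_pair_measure)
    then have nA: "X \<notin> A m" "Y \<notin> A n" using nE by (auto simp: XY)
    have grid: "\<bar>real k * ecdf k Z t - real k * cdf F t\<bar>
        \<le> 2 * (1 + x) * sqrt (1 + real N * (cdf F t * (1 - cdf F t)))"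
      if k: "k \<le> N" and Z: "Z \<in> space (\<Pi>\<^sub>M i\<in>{..<k}. F)" "Z \<notin> A k" for k Z t
    proof (rule deviation_from_grid[where q = q and c = "\<lambda>t. real k * ecdf k Z t"])
      show "mono (cdf F)" by (intro monoI F.cdf_nondecreasing)
      show "mono (\<lambda>t. real k * ecdf k Z t)" by (intro monoI mult_left_mono ecdf_mono) auto
      fix j assume j: "j \<in> {1..<N}"
      show "cdf F (q j) = real j / real N" by (rule q[OF j])
      show "\<bar>real k * ecdf k Z (q j) - real k * cdf F (q j)\<bar>
          \<le> x * sqrt (1 + real k * (cdf F (q j) * (1 - cdf F (q j))))"
      proof -
        have "Z \<notin> deviant k F x (q j)" using Z(2) j by (auto simp: A_def)
        then show ?thesis using Z(1) unfolding deviant_def by simp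
      qed
    qed (use k mn x ecdf_bounds[of k Z] in
        \<open>auto simp: N_def F.cdf_nonneg F.cdf_bounded_prob mult_left_le\<close>)
    have "HC m n (X, Y) \<le> max (24 * (1 + x)\<^sup>2 * (real (m + n) / sqrt (real m * real n))) (Sup {})"
    proof (rule HC_le)
      fix t assume h: "0 < pooled_ecdf m n (X, Y) t" "pooled_ecdf m n (X, Y) t < 1"
      let ?h = "pooled_ecdf m n (X, Y) t"
      \<comment> \<open>The pooled value is an integer multiple of \<open>1 / N\<close>, so being
        strictly between 0 and 1 keeps it \<open>1 / N\<close> away from both.\<close>
      obtain i where i: "?h = real i / real (m + n)"
      proof
        show "?h = real (card {i\<in>{..<m}. X i \<le> t} + card {i\<in>{..<n}. Y i \<le> t}) / real (m + n)"
          using mn by (simp add: pooled_ecdf_def ecdf_def)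
      qed
      then have "0 < i" "i < m + n" using h mn by (auto simp: zero_less_divide_iff)
      then have h1: "1 / real (m + n) \<le> ?h" "?h \<le> 1 - 1 / real (m + n)"
        using divide_right_mono[of "real i + 1" "real (m + n)" "real (m + n)"] mn
        by (auto simp: i divide_right_mono add_divide_distrib)
      have "sqrt (real m * real n / real (m + n)) * ((ecdf m X t - ecdf n Y t) /
          sqrt (?h * (1 - ?h))) \<le> 24 * (1 + x)\<^sup>2 * (real (m + n) / sqrt (real m * real n))"
        by (rule normalised_difference_le[OF mn x F.cdf_nonneg F.cdf_bounded_prob refl
              grid[OF _ sp(1) nA(1), unfolded N_def] grid[OF _ sp(2) nA(2), unfolded N_def] _ h1])
          (auto simp: pooled_ecdf_def)
      then show "sqrt (real m * real n / real (m + n)) * ((ecdf m X t - ecdf n Y t) /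
          sqrt (?h * (1 - ?h)))
          \<le> max (24 * (1 + x)\<^sup>2 * (real (m + n) / sqrt (real m * real n))) (Sup {})" by simp
    qed simp
    then show False using \<omega> c by (auto simp: XY le_max_iff_disj)
  qed
  then have "measure (two_sample m n F F) {\<omega> \<in> space (two_sample m n F F). c \<le> HC m n \<omega>}
      \<le> measure (two_sample m n F F) ?E"
    by (rule measure_le_of_subset[OF P.finite_measure_axioms _ sets_two_sample_Un[OF F(1) F(1) sA sA]])
  also have "\<dots> \<le> 2 * real N * exp (1 - x) + 2 * real N * exp (1 - x)"
    by (rule order_trans[OF measure_two_sample_Un[OF F(1) F(1) sA sA] add_mono[OF mA mA]])
  finally show ?thesis by (simp add: N_def algebra_simps)
qed

section \<open>The alternative: the statistic at a single threshold\<close>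

text \<open>The fluctuation unit is \<open>e = sqrt (v / n)\<close>. The two samples lose at most
  \<open>3 * x * e\<close> and \<open>2 * x * e\<close>, and the gap is at least
  \<open>10 * x * e\<close>, so half of it survives. Since \<open>1 \<le> n * v\<close> gives
  \<open>e \<le> v\<close>, the upper tail of the pooled sample is at most
  \<open>v * (1 + 3 * x)\<close>, which bounds the normaliser.\<close>

lemma separated_difference_ge:
  fixes a b p q h x :: real and m n :: nat
  assumes n: "0 < n" "real n \<le> 2 * real m" and x: "0 \<le> x"
    and pq: "q \<le> p" "p \<le> 1" "0 \<le> q"
    and v: "v = 1 - q" "1 \<le> real n * v" and D: "0 < p - q" "10 * x * sqrt (v / real n) \<le> p - q"
    and a: "\<bar>real m * a - real m * p\<bar> \<le> x * sqrt (1 + real m * (p * (1 - p)))"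
    and b: "\<bar>real n * b - real n * q\<bar> \<le> x * sqrt (1 + real n * (q * (1 - q)))"
    and ab: "0 \<le> b" "a \<le> 1"
    and h: "h = (real m * a + real n * b) / real (m + n)"
  shows "0 < h" "h < 1"
    and "(p - q) * sqrt (real n / v) / (4 * sqrt (1 + 3 * x))
      \<le> sqrt (real m * real n / real (m + n)) * ((a - b) / sqrt (h * (1 - h)))"
proof -
  define e where "e = sqrt (v / real n)"
  have m: "0 < m" using n by (cases m) auto
  have v0: "0 < v" using v(2) n by (smt (verit) mult_nonneg_nonpos of_nat_0_le_iff)
  have e0: "0 < e" using v0 n by (simp add: e_def)
  have e2: "e\<^sup>2 = v / real n" using v0 n by (simp add: e_def)
  have mv: "1 \<le> 2 * real m * v"
    using v(2) mult_right_mono[OF n(2), of v] v0 by linarith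
  have ev: "e \<le> v"
    unfolding e_def
  proof (rule real_le_lsqrt)
    have "1 * v \<le> real n * v * v" using v v0 by (intro mult_right_mono) auto
    then show "v / real n \<le> v\<^sup>2" using n by (simp add: field_simps power2_eq_square)
  qed (use v0 in auto)
  have sm: "sqrt (1 + real m * (p * (1 - p))) \<le> real m * (3 * e)"
  proof (rule real_le_lsqrt)
    have "p * (1 - p) \<le> 1 * v" using pq v by (intro mult_mono) auto
    then have "1 + real m * (p * (1 - p)) \<le> 1 + real m * v"
      by (simp add: mult_left_mono)
    also have "\<dots> \<le> 3 * real m * v" using mv by linarith
    \<comment> \<open>Enlarging 3 to 9/2 prepares for \<open>n \<le> 2 * m\<close>, which yields
      \<open>9 * m * v / 2 \<le> 9 * m^2 * v / n\<close>, the required square.\<close>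
    also have "\<dots> \<le> 9 * real m * v / 2" using mv by linarith
    also have "\<dots> \<le> (real m * (3 * e))\<^sup>2"
    proof -
      have "9 * real m * v * real n \<le> 9 * real m * v * (2 * real m)"
        using n v0 by (intro mult_left_mono) auto
      then have "9 * real m * v / 2 \<le> 9 * (real m * real m) * v / real n"
        using n by (simp add: field_simps)
      also have "\<dots> = (real m * (3 * e))\<^sup>2"
        by (simp add: power_mult_distrib e2) (simp add: power2_eq_square)
      finally show ?thesis .
    qed
    finally show "1 + real m * (p * (1 - p)) \<le> (real m * (3 * e))\<^sup>2" .
  qed (use pq e0 in auto)
  have sn: "sqrt (1 + real n * (q * (1 - q))) \<le> real n * (2 * e)"
  proof (rule real_le_lsqrt)
    have "q * (1 - q) \<le> 1 * v" using pq v by (intro mult_mono) auto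
    then have "1 + real n * (q * (1 - q)) \<le> 1 + real n * v"
      by (simp add: mult_left_mono)
    also have "\<dots> \<le> 4 * real n * v" using v by linarith
    also have "\<dots> = (real n * (2 * e))\<^sup>2"
      using n by (simp add: power_mult_distrib e2) (simp add: power2_eq_square)
    finally show "1 + real n * (q * (1 - q)) \<le> (real n * (2 * e))\<^sup>2" .
  qed (use pq e0 in auto)
  have da: "\<bar>a - p\<bar> \<le> x * (3 * e)"
  proof -
    have "real m * \<bar>a - p\<bar> = \<bar>real m * a - real m * p\<bar>"
      by (simp add: abs_mult right_diff_distrib[symmetric])
    also have "\<dots> \<le> real m * (x * (3 * e))"
      using order_trans[OF a mult_left_mono[OF sm x]] by (simp add: mult_ac)
    finally show ?thesis using m by simp
  qed
  have db: "\<bar>b - q\<bar> \<le> x * (2 * e)"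
  proof -
    have "real n * \<bar>b - q\<bar> = \<bar>real n * b - real n * q\<bar>"
      by (simp add: abs_mult right_diff_distrib[symmetric])
    also have "\<dots> \<le> real n * (x * (2 * e))"
      using order_trans[OF b mult_left_mono[OF sn x]] by (simp add: mult_ac)
    finally show ?thesis using n by simp
  qed
  have D': "10 * (x * e) \<le> p - q" using D(2) by (simp add: e_def)
  have gap: "(p - q) / 2 \<le> a - b" using da db D' by (simp add: abs_le_iff)
  then have "b < a" using D(1) by simp
  have N: "0 < real (m + n)" using n by simp
  have "0 < real m * a + real n * b" using \<open>b < a\<close> ab m by (intro add_pos_nonneg mult_pos_pos) auto
  then show h0: "0 < h" unfolding h using N by simp
  have "real m * a + real n * b < real m * 1 + real n * 1"
    using \<open>b < a\<close> ab n by (intro add_le_less_mono mult_left_mono mult_strict_left_mono) auto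
  then show h1: "h < 1" unfolding h using N by (simp add: divide_less_eq)
  have upper: "1 - h \<le> v * (1 + 3 * x)"
  proof -
    have xe: "0 \<le> x * e" "x * e \<le> x * v" using x e0 ev by (auto intro: mult_left_mono)
    have vx: "v * (1 + 3 * x) = v + 3 * (x * v)" by (simp add: algebra_simps)
    have "1 - a \<le> v * (1 + 3 * x)"
      using abs_le_D2[OF da] xe v(1) pq(1) unfolding vx by simp
    moreover have "1 - b \<le> v * (1 + 3 * x)"
      using abs_le_D2[OF db] xe v(1) unfolding vx by simp
    moreover have "real (m + n) * (1 - h) = real m * (1 - a) + real n * (1 - b)"
    proof -
      have "real (m + n) * h = real m * a + real n * b" using N by (simp add: h del: of_nat_add)
      then show ?thesis by (simp add: algebra_simps)
    qed
    ultimately have "real (m + n) * (1 - h)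
        \<le> real m * (v * (1 + 3 * x)) + real n * (v * (1 + 3 * x))"
      by (simp add: add_mono mult_left_mono del: of_nat_add)
    also have "\<dots> = real (m + n) * (v * (1 + 3 * x))" by (simp add: algebra_simps)
    finally show ?thesis using N by (simp del: of_nat_add)
  qed
  have "h * (1 - h) \<le> v * (1 + 3 * x)"
    using upper h0 h1 by (smt (verit) mult_left_le_one_le)
  then have s: "sqrt (h * (1 - h)) \<le> sqrt v * sqrt (1 + 3 * x)"
    using real_sqrt_le_mono real_sqrt_mult by metis
  have s0: "0 < sqrt (h * (1 - h))" using h0 h1 by simp
  \<comment> \<open>The assumption gives 3 in place of 4; 4 is used for its rational root.\<close>
  have "real n / 4 \<le> real m * real n / real (m + n)"
  proof -
    have "real n * real (m + n) \<le> real n * (4 * real m)" using n by (intro mult_left_mono) auto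
    then show ?thesis using N by (simp add: field_simps)
  qed
  then have r: "sqrt (real n) / 2 \<le> sqrt (real m * real n / real (m + n))"
    using real_sqrt_le_mono real_sqrt_divide[of "real n" 4] real_sqrt_four by metis
  have "(p - q) * sqrt (real n / v) / (4 * sqrt (1 + 3 * x))
      = sqrt (real n) / 2 * (((p - q) / 2) / (sqrt v * sqrt (1 + 3 * x)))"
    by (simp add: real_sqrt_divide mult_ac)
  also have "\<dots> \<le> sqrt (real m * real n / real (m + n)) * ((a - b) / sqrt (h * (1 - h)))"
    using r gap s s0 D(1) v0 x by (intro mult_mono frac_le) auto
  finally show "(p - q) * sqrt (real n / v) / (4 * sqrt (1 + 3 * x))
      \<le> sqrt (real m * real n / real (m + n)) * ((a - b) / sqrt (h * (1 - h)))" .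
qed

lemma HC_alternative_tail:
  assumes F: "real_distribution F" and G: "real_distribution G"
    and n: "0 < n" "real n \<le> 2 * real m" and x: "0 \<le> x"
    and D: "cdf G t < cdf F t" "1 \<le> real n * (1 - cdf G t)"
      "10 * x * sqrt ((1 - cdf G t) / real n) \<le> cdf F t - cdf G t"
    and c: "c \<le> (cdf F t - cdf G t) * sqrt (real n / (1 - cdf G t)) / (4 * sqrt (1 + 3 * x))"
  shows "measure (two_sample m n F G) {\<omega> \<in> space (two_sample m n F G). \<not> c \<le> HC m n \<omega>}
    \<le> 4 * exp (1 - x)"
proof -
  interpret F: real_distribution F by fact
  interpret G: real_distribution G by fact
  interpret P: prob_space "two_sample m n F G" by (rule prob_space_two_sample[OF F G])
  note sets = sets_deviant[OF F, of m x t] sets_deviant[OF G, of n x t]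
  let ?E = "deviant m F x t \<times> space (\<Pi>\<^sub>M i\<in>{..<n}. G) \<union> space (\<Pi>\<^sub>M i\<in>{..<m}. F) \<times> deviant n G x t"
  have "{\<omega> \<in> space (two_sample m n F G). \<not> c \<le> HC m n \<omega>} \<subseteq> ?E"
  proof (rule subsetI, rule ccontr)
    fix \<omega> assume \<omega>: "\<omega> \<in> {\<omega> \<in> space (two_sample m n F G). \<not> c \<le> HC m n \<omega>}" and nE: "\<omega> \<notin> ?E"
    obtain X Y where XY: "\<omega> = (X, Y)" by (cases \<omega>)
    have sp: "X \<in> space (\<Pi>\<^sub>M i\<in>{..<m}. F)" "Y \<in> space (\<Pi>\<^sub>M i\<in>{..<n}. G)"
      using \<omega> by (auto simp: XY two_sample_def space_pair_measure)
    then have "X \<notin> deviant m F x t" "Y \<notin> deviant n G x t" using nE by (auto simp: XY)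
    with sp have dev: "\<bar>real m * ecdf m X t - real m * cdf F t\<bar>
          \<le> x * sqrt (1 + real m * (cdf F t * (1 - cdf F t)))"
        "\<bar>real n * ecdf n Y t - real n * cdf G t\<bar>
          \<le> x * sqrt (1 + real n * (cdf G t * (1 - cdf G t)))"
      by (auto simp: deviant_def)
    have h: "pooled_ecdf m n (X, Y) t = (real m * ecdf m X t + real n * ecdf n Y t) / real (m + n)"
      by (simp add: pooled_ecdf_def)
    have D0: "0 < cdf F t - cdf G t" using D(1) by simp
    note sep = separated_difference_ge[OF n x less_imp_le[OF D(1)] F.cdf_bounded_prob G.cdf_nonneg
        refl D(2) D0 D(3) dev ecdf_bounds(1) ecdf_bounds(2) h]
    have "c \<le> HC m n (X, Y)"
      by (rule order_trans[OF c order_trans[OF sep(3) HC_ge[OF sep(1) sep(2)]]])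
    then show False using \<omega> by (simp add: XY)
  qed
  then have "measure (two_sample m n F G) {\<omega> \<in> space (two_sample m n F G). \<not> c \<le> HC m n \<omega>}
      \<le> measure (two_sample m n F G) ?E"
    by (rule measure_le_of_subset[OF P.finite_measure_axioms _ sets_two_sample_Un[OF F G sets]])
  also have "\<dots> \<le> 2 * exp (1 - x) + 2 * exp (1 - x)"
    by (rule order_trans[OF measure_two_sample_Un[OF F G sets]
          add_mono[OF measure_deviant_le[OF F] measure_deviant_le[OF G]]])
  finally show ?thesis by simp
qed

section \<open>From a separating threshold to vanishing risk\<close>

text \<open>Separation says that the standardised gap at \<open>t n\<close> is at least
  \<open>n powr \<delta>\<close>. Dividing by the factor of order \<open>sqrt (ln n)\<close> from
  the alternative still leaves more than the critical value, and the latter beats the squared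
  logarithm from the null bound.\<close>

theorem HC_powerful_if_separated:
  fixes m :: "nat \<Rightarrow> nat" and t :: "nat \<Rightarrow> real"
  assumes F: "real_distribution F" "\<And>t. isCont (cdf F) t"
    and G: "\<forall>\<^sub>F n in sequentially. real_distribution (G n)"
    and m: "\<forall>\<^sub>F n in sequentially. real n \<le> 2 * real (m n)"
      "\<forall>\<^sub>F n in sequentially. real (m n + n) \<le> K * real n"
    and \<delta>: "0 < \<delta>"
    and sep: "\<forall>\<^sub>F n in sequentially. cdf (G n) (t n) < cdf F (t n) \<and>
      real n powr (2 * \<delta>) * (1 - cdf (G n) (t n)) \<le> real n * (cdf F (t n) - cdf (G n) (t n))\<^sup>2"
  shows "HC_asymptotically_powerful m F G"
proof -
  interpret F: real_distribution F by fact
  define K' where "K' = max K 1"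
  have K': "1 \<le> K'" by (simp add: K'_def)
  define c where "c n = real n powr (\<delta> / 2)" for n :: nat
  have "\<forall>\<^sub>F n :: nat in sequentially. 48 * K' * (1 + 2 * ln (K' * real n))\<^sup>2 < real n powr (\<delta> / 2)"
    using K' \<delta> by real_asymp
  \<comment> \<open>\<open>Sup {}\<close> is some fixed real, so a critical value tending to
    infinity eventually exceeds it.\<close>
  moreover have "\<forall>\<^sub>F n :: nat in sequentially. Sup {} < real n powr (\<delta> / 2)"
    using \<delta> by real_asymp
  moreover have "\<forall>\<^sub>F n :: nat in sequentially. 10 * ln (real n) \<le> real n powr \<delta>"
    using \<delta> by real_asymp
  moreover have "\<forall>\<^sub>F n :: nat in sequentially.
      real n powr (\<delta> / 2) \<le> real n powr \<delta> / (4 * sqrt (1 + 3 * ln (real n)))"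
    using \<delta> by real_asymp
  ultimately have bound: "\<forall>\<^sub>F n in sequentially.
      risk (two_sample (m n) n F F) (two_sample (m n) n F (G n)) (\<lambda>\<omega>. c n \<le> HC (m n) n \<omega>)
      \<le> 8 * exp 1 / real n"
    using G m sep eventually_ge_at_top[of 2]
  proof eventually_elim
    case (elim n)
    have n: "2 \<le> n" "0 < n" using elim by auto
    have m0: "0 < m n" using elim(6) n by (cases "m n") auto
    let ?N = "m n + n"
    have N: "0 < real ?N" using n by simp
    have NK: "real ?N \<le> K' * real n"
      using elim(7) n by (smt (verit) K'_def max.cobounded1 mult_right_mono of_nat_0_le_iff)
    have ratio: "real ?N / sqrt (real (m n) * real n) \<le> 2 * K'"
    proof -
      have "(real n / 2)\<^sup>2 \<le> real (m n) * real n"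
        using elim(6) n by (simp add: power2_eq_square mult_right_mono)
      from real_le_rsqrt[OF this] have "real n / 2 \<le> sqrt (real (m n) * real n)" .
      then have "K' * real n \<le> 2 * K' * sqrt (real (m n) * real n)"
        using K' by (simp add: mult_left_mono)
      then show ?thesis using NK n m0 by (simp add: divide_le_eq)
    qed
    \<comment> \<open>One factor \<open>1 / N\<close> of \<open>exp (- ?x)\<close> pays for the
      union over the grid; the other makes the error probability vanish.\<close>
    let ?x = "2 * ln (real ?N)"
    have "ln (real ?N) \<le> ln (K' * real n)" using NK N by simp
    then have "(1 + ?x)\<^sup>2 \<le> (1 + 2 * ln (K' * real n))\<^sup>2"
      using n by (intro power_mono) auto
    then have "24 * (1 + ?x)\<^sup>2 * (real ?N / sqrt (real (m n) * real n))
        \<le> 24 * (1 + 2 * ln (K' * real n))\<^sup>2 * (2 * K')"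
      using ratio by (intro mult_mono) auto
    also have "\<dots> < c n" using elim(1) by (simp add: c_def mult_ac)
    finally have c1: "24 * (1 + ?x)\<^sup>2 * (real ?N / sqrt (real (m n) * real n)) < c n" .
    have "exp (1 - ?x) = exp 1 / (real ?N)\<^sup>2"
      using N exp_of_nat_mult[of 2 "ln (real ?N)"] by (simp add: exp_diff del: of_nat_add)
    then have "4 * real ?N * exp (1 - ?x) = 4 * exp 1 / real ?N"
      using N m0 by (simp add: power2_eq_square del: of_nat_add)
    also have "\<dots> \<le> 4 * exp 1 / real n" using n by (intro divide_left_mono) auto
    finally have null: "measure (two_sample (m n) n F F)
        {\<omega> \<in> space (two_sample (m n) n F F). c n \<le> HC (m n) n \<omega>} \<le> 4 * exp 1 / real n"
      using HC_null_tail[OF F m0 n(2) _ c1] elim(2) n by (fastforce simp: c_def)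
    define v where "v = 1 - cdf (G n) (t n)"
    define D where "D = cdf F (t n) - cdf (G n) (t n)"
    have D: "0 < D" "real n powr (2 * \<delta>) * v \<le> real n * D\<^sup>2"
      using elim(8) by (auto simp: D_def v_def)
    \<comment> \<open>This turns separation into \<open>n powr (2 * \<delta>) \<le> n * v\<close>,
      hence into the hypothesis \<open>1 \<le> n * v\<close> of the alternative bound.\<close>
    have Dv: "D \<le> v" using F.cdf_bounded_prob[of "t n"] by (simp add: D_def v_def)
    have v: "0 < v" using Dv D by simp
    have "real n powr (2 * \<delta>) * v \<le> real n * (v * v)"
    proof -
      have "real n * D\<^sup>2 \<le> real n * (v * v)"
        unfolding power2_eq_square using Dv D(1) by (intro mult_left_mono mult_mono) auto
      with D(2) show ?thesis by linarith
    qed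
    then have "real n powr (2 * \<delta>) * v \<le> (real n * v) * v" by simp
    then have "real n powr (2 * \<delta>) \<le> real n * v" using v by simp
    moreover have "1 \<le> real n powr (2 * \<delta>)" using n \<delta> by (intro ge_one_powr_ge_zero) auto
    ultimately have nv: "1 \<le> real n * v" by simp
    have pow: "(real n powr \<delta>)\<^sup>2 = real n powr (2 * \<delta>)"
      using powr_add[of "real n" \<delta> \<delta>] by (simp add: power2_eq_square)
    have Dn: "real n powr \<delta> \<le> D * sqrt (real n / v)"
    proof (rule power2_le_imp_le)
      have "real n powr (2 * \<delta>) \<le> D\<^sup>2 * (real n / v)"
        using D(2) v by (simp add: field_simps)
      then show "(real n powr \<delta>)\<^sup>2 \<le> (D * sqrt (real n / v))\<^sup>2"
        using v unfolding pow by (simp add: power_mult_distrib)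
    qed (use D v in simp)
    have Dx: "10 * ln (real n) * sqrt (v / real n) \<le> D"
    proof -
      have "10 * ln (real n) * sqrt (v / real n) \<le> D * sqrt (real n / v) * sqrt (v / real n)"
        using Dn elim(3) by (intro mult_right_mono) (use v in auto)
      also have "\<dots> = D" using v n by (simp add: real_sqrt_divide)
      finally show ?thesis .
    qed
    have "c n \<le> D * sqrt (real n / v) / (4 * sqrt (1 + 3 * ln (real n)))"
      unfolding c_def by (rule order_trans[OF elim(4) divide_right_mono[OF Dn]]) (use n in auto)
    then have alt: "measure (two_sample (m n) n F (G n))
        {\<omega> \<in> space (two_sample (m n) n F (G n)). \<not> c n \<le> HC (m n) n \<omega>} \<le> 4 * exp (1 - ln (real n))"
      using HC_alternative_tail[OF F(1) elim(5) n(2) elim(6), of "ln (real n)" "t n" "c n"]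
        elim(8) nv Dx n unfolding v_def D_def by simp
    have "4 * exp (1 - ln (real n)) = 4 * exp 1 / real n" using n by (simp add: exp_diff)
    then show ?case using null alt unfolding risk_def by simp
  qed
  have "(\<lambda>n. 8 * exp 1 / real n) \<longlonglongrightarrow> 0" by real_asymp
  then have "(\<lambda>n. risk (two_sample (m n) n F F) (two_sample (m n) n F (G n))
      (\<lambda>\<omega>. c n \<le> HC (m n) n \<omega>)) \<longlonglongrightarrow> 0"
    by (rule tendsto_sandwich[rotated 2, OF tendsto_const])
      (use bound in \<open>auto simp: risk_def intro!: always_eventually\<close>)
  then show ?thesis
    unfolding HC_asymptotically_powerful_def asymptotically_powerful_def by blast
qed

section \<open>The generalized Gaussian distribution\<close>

lemma integrable_exp_minus_powr:
  fixes c \<gamma> :: real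
  assumes "0 < c" "0 < \<gamma>"
  shows "integrable lborel (\<lambda>x. exp (- (c * \<bar>x\<bar> powr \<gamma>)))"
proof -
  have "\<forall>\<^sub>F x in at_top. exp (- (c * x powr \<gamma>)) \<le> inverse (1 + x\<^sup>2)"
    using assms by real_asymp
  then obtain X where X: "\<And>x. X \<le> x \<Longrightarrow> exp (- (c * x powr \<gamma>)) \<le> inverse (1 + x\<^sup>2)"
    by (auto simp: eventually_at_top_linorder)
  have pos: "0 < 1 + x\<^sup>2" for x :: real by (simp add: add_pos_nonneg)
  \<comment> \<open>The factor \<open>1 + X^2\<close> makes the Cauchy-type majorant at least 1
    where the asymptotic comparison is not yet available.\<close>
  have int: "integrable lborel (\<lambda>x::real. (1 + X\<^sup>2) * inverse (1 + x\<^sup>2))"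
    using integrable_inverse_1_plus_square by (simp add: set_integrable_def)
  show ?thesis
  proof (rule Bochner_Integration.integrable_bound[OF int])
    show "AE x in lborel. norm (exp (- (c * \<bar>x\<bar> powr \<gamma>))) \<le> norm ((1 + X\<^sup>2) * inverse (1 + x\<^sup>2))"
    proof (rule AE_I2)
      fix x :: real
      have "exp (- (c * \<bar>x\<bar> powr \<gamma>)) \<le> (1 + X\<^sup>2) * inverse (1 + x\<^sup>2)"
      proof (cases "X \<le> \<bar>x\<bar>")
        case True
        have "1 * inverse (1 + x\<^sup>2) \<le> (1 + X\<^sup>2) * inverse (1 + x\<^sup>2)"
          using pos[of x] by (intro mult_right_mono) auto
        then show ?thesis using X[OF True] by simp
      next
        case False
        then have "x\<^sup>2 \<le> X\<^sup>2" by (simp add: abs_le_square_iff[symmetric])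
        then have "1 \<le> (1 + X\<^sup>2) * inverse (1 + x\<^sup>2)"
          using pos[of x] by (simp add: field_simps)
        moreover have "exp (- (c * \<bar>x\<bar> powr \<gamma>)) \<le> 1" using assms by simp
        ultimately show ?thesis by linarith
      qed
      then show "norm (exp (- (c * \<bar>x\<bar> powr \<gamma>))) \<le> norm ((1 + X\<^sup>2) * inverse (1 + x\<^sup>2))"
        by (simp add: abs_mult)
    qed
  qed simp
qed

lemma gen_gauss_const_pos:
  assumes "0 < \<gamma>"
  shows "0 < gen_gauss_const \<gamma>"
proof -
  have int: "integrable lborel (\<lambda>x. exp (- (\<bar>x\<bar> powr \<gamma> / \<gamma>)))"
    using integrable_exp_minus_powr[of "1 / \<gamma>" \<gamma>] assms by simp
  have "exp (- (1 / \<gamma>)) = (LINT x|lborel. exp (- (1 / \<gamma>)) * indicator {0..1::real} x)"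
    by simp
  also have "\<dots> \<le> (LINT x|lborel. exp (- (\<bar>x\<bar> powr \<gamma> / \<gamma>)))"
  proof (rule integral_mono[OF _ int])
    show "integrable lborel (\<lambda>x::real. exp (- (1 / \<gamma>)) * indicator {0..1} x)"
      by (intro integrable_mult_right integrable_real_indicator) auto
  qed (use assms in \<open>auto simp: indicator_def divide_right_mono powr_le1\<close>)
  finally show ?thesis unfolding gen_gauss_const_def using exp_gt_zero less_le_trans by blast
qed

lemma real_distribution_gen_gauss:
  assumes "0 < \<gamma>"
  shows "real_distribution (gen_gauss \<gamma>)"
proof -
  have int: "integrable lborel (\<lambda>x. exp (- (\<bar>x\<bar> powr \<gamma> / \<gamma>)))"
    using integrable_exp_minus_powr[of "1 / \<gamma>" \<gamma>] assms by simp
  have "emeasure (gen_gauss \<gamma>) (space (gen_gauss \<gamma>))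
      = (\<integral>\<^sup>+x. ennreal (exp (- (\<bar>x\<bar> powr \<gamma> / \<gamma>)) / gen_gauss_const \<gamma>) \<partial>lborel)"
    by (simp add: gen_gauss_def emeasure_density)
  also have "\<dots> = ennreal (LINT x|lborel. exp (- (\<bar>x\<bar> powr \<gamma> / \<gamma>)) / gen_gauss_const \<gamma>)"
    using int gen_gauss_const_pos[OF assms] by (intro nn_integral_eq_integral) auto
  also have "\<dots> = 1"
    using gen_gauss_const_pos[OF assms] by (simp add: gen_gauss_const_def[symmetric])
  finally have "prob_space (gen_gauss \<gamma>)" by (rule prob_spaceI)
  then show ?thesis
    by (auto simp: real_distribution_def real_distribution_axioms_def gen_gauss_def)
qed

lemma isCont_cdf_gen_gauss:
  assumes "0 < \<gamma>"
  shows "isCont (cdf (gen_gauss \<gamma>)) t"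
proof -
  interpret real_distribution "gen_gauss \<gamma>" by (rule real_distribution_gen_gauss[OF assms])
  have "emeasure (gen_gauss \<gamma>) {t} = 0"
    by (simp add: gen_gauss_def emeasure_density nn_integral_indicator_singleton)
  then show ?thesis by (simp add: isCont_cdf measure_def)
qed

lemma gen_gauss_interval_ge:
  assumes "0 < \<gamma>" "a \<le> b" "\<And>x. a < x \<Longrightarrow> x \<le> b \<Longrightarrow> \<bar>x\<bar> \<le> z"
  shows "(b - a) * exp (- (z powr \<gamma> / \<gamma>)) / gen_gauss_const \<gamma>
    \<le> cdf (gen_gauss \<gamma>) b - cdf (gen_gauss \<gamma>) a"
proof (cases "a = b")
  case False
  interpret real_distribution "gen_gauss \<gamma>" by (rule real_distribution_gen_gauss[OF assms(1)])
  define k where "k = exp (- (z powr \<gamma> / \<gamma>)) / gen_gauss_const \<gamma>"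
  have k: "0 \<le> k" using gen_gauss_const_pos[OF assms(1)] by (simp add: k_def)
  have "ennreal (k * (b - a)) = ennreal k * emeasure lborel {a<..b}"
    using assms(2) k by (simp add: ennreal_mult)
  also have "\<dots> = (\<integral>\<^sup>+x. ennreal k * indicator {a<..b} x \<partial>lborel)"
    by (simp add: nn_integral_cmult_indicator)
  also have "\<dots> \<le> (\<integral>\<^sup>+x. ennreal (exp (- (\<bar>x\<bar> powr \<gamma> / \<gamma>)) / gen_gauss_const \<gamma>)
      * indicator {a<..b} x \<partial>lborel)"
    using assms gen_gauss_const_pos[OF assms(1)]
    by (intro nn_integral_mono)
      (auto simp: indicator_def k_def intro!: ennreal_leI divide_right_mono powr_mono2)
  also have "\<dots> = emeasure (gen_gauss \<gamma>) {a<..b}"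
    by (simp add: gen_gauss_def emeasure_density)
  also have "\<dots> = ennreal (measure (gen_gauss \<gamma>) {a<..b})" by (rule emeasure_eq_measure)
  finally have "k * (b - a) \<le> measure (gen_gauss \<gamma>) {a<..b}" by (simp add: ennreal_le_iff)
  also have "\<dots> = cdf (gen_gauss \<gamma>) b - cdf (gen_gauss \<gamma>) a"
    using False assms(2) by (intro cdf_diff_eq[symmetric]) auto
  finally show ?thesis by (simp add: k_def mult_ac)
qed simp

text \<open>Of the exponent, the share \<open>\<theta>\<close> is estimated by its value at
  \<open>t\<close> and the share \<open>1 - \<theta>\<close> is integrated. This treats all
  \<open>\<gamma> > 0\<close> alike, and the loss in the exponent is harmless because the exponent
  inequalities are strict.\<close>

lemma gen_gauss_tail_le:
  assumes "0 < \<gamma>" "0 < \<theta>" "\<theta> < 1"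
  shows "\<exists>C>0. \<forall>t\<ge>0. 1 - cdf (gen_gauss \<gamma>) t \<le> C * exp (- (\<theta> * t powr \<gamma> / \<gamma>))"
proof -
  interpret real_distribution "gen_gauss \<gamma>" by (rule real_distribution_gen_gauss[OF assms(1)])
  define Z where "Z = gen_gauss_const \<gamma>"
  have Z: "0 < Z" using gen_gauss_const_pos[OF assms(1)] by (simp add: Z_def)
  define g where "g x = exp (- ((1 - \<theta>) / \<gamma> * \<bar>x\<bar> powr \<gamma>)) / Z" for x
  have int: "integrable lborel g"
    unfolding g_def using integrable_exp_minus_powr[of "(1 - \<theta>) / \<gamma>" \<gamma>] assms by simp
  have "1 - cdf (gen_gauss \<gamma>) t \<le> (1 + (LINT x|lborel. g x)) * exp (- (\<theta> * t powr \<gamma> / \<gamma>))"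
    if t: "0 \<le> t" for t
  proof -
    define e where "e = exp (- (\<theta> * t powr \<gamma> / \<gamma>))"
    have "1 - cdf (gen_gauss \<gamma>) t = measure (gen_gauss \<gamma>) (UNIV - {..t})"
      using prob_compl[of "{..t}"] by (simp add: cdf_def)
    then have "ennreal (1 - cdf (gen_gauss \<gamma>) t) = emeasure (gen_gauss \<gamma>) {t<..}"
      by (simp add: emeasure_eq_measure Compl_eq_Diff_UNIV[symmetric] Compl_atMost)
    also have "\<dots> = (\<integral>\<^sup>+x. ennreal (exp (- (\<bar>x\<bar> powr \<gamma> / \<gamma>)) / Z) * indicator {t<..} x \<partial>lborel)"
      by (simp add: gen_gauss_def emeasure_density Z_def)
    also have "\<dots> \<le> (\<integral>\<^sup>+x. ennreal (e * g x) \<partial>lborel)"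
    proof (rule nn_integral_mono)
      fix x :: real
      have "exp (- (\<bar>x\<bar> powr \<gamma> / \<gamma>)) / Z \<le> e * g x" if "t < x"
      proof -
        have "t powr \<gamma> \<le> \<bar>x\<bar> powr \<gamma>" using that t assms by (intro powr_mono2) auto
        then have "\<theta> / \<gamma> * t powr \<gamma> \<le> \<theta> / \<gamma> * \<bar>x\<bar> powr \<gamma>" using assms by (intro mult_left_mono) auto
        then have "- (\<bar>x\<bar> powr \<gamma> / \<gamma>) \<le> - (\<theta> * t powr \<gamma> / \<gamma>) + - ((1 - \<theta>) / \<gamma> * \<bar>x\<bar> powr \<gamma>)"
          by (simp add: algebra_simps diff_divide_distrib)
        then have "exp (- (\<bar>x\<bar> powr \<gamma> / \<gamma>)) \<le> e * exp (- ((1 - \<theta>) / \<gamma> * \<bar>x\<bar> powr \<gamma>))"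
          unfolding e_def exp_add[symmetric] by simp
        then show ?thesis using Z by (simp add: g_def divide_right_mono)
      qed
      then show "ennreal (exp (- (\<bar>x\<bar> powr \<gamma> / \<gamma>)) / Z) * indicator {t<..} x \<le> ennreal (e * g x)"
        by (auto simp: indicator_def intro!: ennreal_leI)
    qed
    also have "\<dots> = ennreal (LINT x|lborel. e * g x)"
      using Z by (intro nn_integral_eq_integral integrable_mult_right[OF int]) (auto simp: e_def g_def)
    finally have "1 - cdf (gen_gauss \<gamma>) t \<le> e * (LINT x|lborel. g x)"
      using Z by (subst (asm) ennreal_le_iff) (auto simp: e_def g_def intro!: mult_nonneg_nonneg integral_nonneg_AE)
    also have "\<dots> \<le> (1 + (LINT x|lborel. g x)) * e" by (simp add: e_def algebra_simps)
    finally show ?thesis by (simp add: e_def)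
  qed
  moreover have "0 < 1 + (LINT x|lborel. g x)"
    using Z by (intro add_pos_nonneg integral_nonneg_AE) (auto simp: g_def)
  ultimately show ?thesis by blast
qed

section \<open>Location of the separating threshold\<close>

lemma contaminated_cdf_gap:
  assumes "real_distribution F" "0 \<le> \<epsilon>" "\<epsilon> \<le> 1"
  shows "cdf F t - cdf (contaminated F \<epsilon> \<mu>) t = \<epsilon> * (cdf F t - cdf F (t - \<mu>))"
  by (simp add: contaminated_cdf(2)[OF assms] algebra_simps)

text \<open>Near the mode the density is bounded below, so the gap at 0 is of order at least
  \<open>n powr (s - 1 / 2 - \<beta>)\<close> and \<open>n\<close> times its square at least
  \<open>n powr (2 * (s - \<beta>))\<close>. Half of this exponent is claimed as
  \<open>2 * \<delta>\<close>; the rest absorbs the constant.\<close>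

lemma gen_gauss_dense_powerful:
  fixes m :: "nat \<Rightarrow> nat"
  assumes \<gamma>: "0 < \<gamma>" and \<beta>: "0 < \<beta>" "\<beta> < s" "s < 1 / 2"
    and m: "\<forall>\<^sub>F n in sequentially. real n \<le> 2 * real (m n)"
      "\<forall>\<^sub>F n in sequentially. real (m n + n) \<le> K * real n"
  shows "HC_asymptotically_powerful m (gen_gauss \<gamma>)
    (\<lambda>n. contaminated (gen_gauss \<gamma>) (real n powr (- \<beta>)) (real n powr (s - 1 / 2)))"
proof -
  note F = real_distribution_gen_gauss[OF \<gamma>]
  interpret F: real_distribution "gen_gauss \<gamma>" by (rule F)
  have \<epsilon>: "real n powr (- \<beta>) \<le> 1" for n
    using \<beta> by (cases "n = 0") (auto simp: powr_minus_divide ge_one_powr_ge_zero)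
  define k where "k = exp (- (1 powr \<gamma> / \<gamma>)) / gen_gauss_const \<gamma>"
  have k: "0 < k" using gen_gauss_const_pos[OF \<gamma>] by (simp add: k_def)
  have G: "real_distribution (contaminated (gen_gauss \<gamma>) (real n powr (- \<beta>)) (real n powr (s - 1 / 2)))" for n
    by (rule contaminated_cdf(1)[OF F]) (use \<epsilon> in auto)
  have sep: "\<forall>\<^sub>F n in sequentially.
      cdf (contaminated (gen_gauss \<gamma>) (real n powr (- \<beta>)) (real n powr (s - 1 / 2))) 0
        < cdf (gen_gauss \<gamma>) 0 \<and>
      real n powr (2 * ((s - \<beta>) / 2)) *
        (1 - cdf (contaminated (gen_gauss \<gamma>) (real n powr (- \<beta>)) (real n powr (s - 1 / 2))) 0)
      \<le> real n * (cdf (gen_gauss \<gamma>) 0 -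
        cdf (contaminated (gen_gauss \<gamma>) (real n powr (- \<beta>)) (real n powr (s - 1 / 2))) 0)\<^sup>2"
  proof -
    have "\<forall>\<^sub>F n :: nat in sequentially. real n powr (2 * ((s - \<beta>) / 2))
        \<le> real n * (real n powr (- \<beta>) * (real n powr (s - 1 / 2) * k))\<^sup>2"
      using \<beta> k by real_asymp
    then show ?thesis using eventually_ge_at_top[of 1]
    proof eventually_elim
      case (elim n)
      define \<mu> where "\<mu> = real n powr (s - 1 / 2)"
      define q where "q = cdf (contaminated (gen_gauss \<gamma>) (real n powr (- \<beta>)) \<mu>) 0"
      define D where "D = cdf (gen_gauss \<gamma>) 0 - q"
      have \<mu>: "0 < \<mu>" "\<mu> \<le> 1"
        using elim(2) \<beta> powr_mono[of "s - 1 / 2" 0 "real n"] by (auto simp: \<mu>_def)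
      have "\<mu> * k \<le> cdf (gen_gauss \<gamma>) 0 - cdf (gen_gauss \<gamma>) (- \<mu>)"
        using gen_gauss_interval_ge[OF \<gamma>, of "- \<mu>" 0 1] \<mu> by (simp add: k_def)
      then have Dge: "real n powr (- \<beta>) * (\<mu> * k) \<le> D"
        using contaminated_cdf_gap[OF F _ \<epsilon>[of n], of 0 \<mu>] by (simp add: D_def q_def mult_left_mono)
      have pos: "0 < real n powr (- \<beta>) * (\<mu> * k)" using elim(2) \<mu> k by simp
      have q0: "0 \<le> q"
        unfolding q_def \<mu>_def
        by (rule finite_borel_measure.cdf_nonneg[OF real_distribution.finite_borel_measure_M[OF G]])
      have "real n powr (2 * ((s - \<beta>) / 2)) * (1 - q) \<le> real n powr (2 * ((s - \<beta>) / 2)) * 1"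
        using q0 by (intro mult_left_mono) auto
      also have "\<dots> \<le> real n * (real n powr (- \<beta>) * (\<mu> * k))\<^sup>2"
        using elim(1) by (simp add: \<mu>_def)
      also have "\<dots> \<le> real n * D\<^sup>2"
        using Dge pos by (intro mult_left_mono power_mono) auto
      finally show ?case using Dge pos by (simp add: D_def q_def \<mu>_def)
    qed
  qed
  show ?thesis
    by (rule HC_powerful_if_separated[OF F isCont_cdf_gen_gauss[OF \<gamma>] always_eventually m _ sep])
      (use G \<beta> in auto)
qed

text \<open>With gap \<open>D\<close>, the tail \<open>1 - G\<close> is \<open>1 - F\<close> plus
  \<open>D\<close>, and separation is shown for each summand. The gap is at least of order
  \<open>n powr (- \<beta> - B)\<close> with \<open>B\<close> slightly above
  \<open>b powr \<gamma>\<close>. The summand \<open>D\<close> then needs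
  \<open>B < 1 - \<beta>\<close>, and \<open>1 - F\<close>, of order at most
  \<open>n powr (- \<theta> * A)\<close>, needs
  \<open>2 * \<beta> - 1 + 2 * B < \<theta> * A\<close>. The assumptions \<open>exps\<close> are
  these conditions at \<open>B = b powr \<gamma>\<close> and \<open>\<theta> = 1\<close>.\<close>

lemma gen_gauss_sparse_powerful:
  fixes m :: "nat \<Rightarrow> nat"
  assumes \<gamma>: "0 < \<gamma>" and \<beta>: "0 < \<beta>" and r: "0 < r"
    and ab: "0 \<le> b" "b < a" "a - r powr (1 / \<gamma>) \<le> b"
    and exps: "b powr \<gamma> < 1 - \<beta>" "2 * \<beta> - 1 < a powr \<gamma> - 2 * b powr \<gamma>"
    and m: "\<forall>\<^sub>F n in sequentially. real n \<le> 2 * real (m n)"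
      "\<forall>\<^sub>F n in sequentially. real (m n + n) \<le> K * real n"
  shows "HC_asymptotically_powerful m (gen_gauss \<gamma>)
    (\<lambda>n. contaminated (gen_gauss \<gamma>) (real n powr (- \<beta>)) ((\<gamma> * r * ln (real n)) powr (1 / \<gamma>)))"
proof -
  note F = real_distribution_gen_gauss[OF \<gamma>]
  interpret F: real_distribution "gen_gauss \<gamma>" by (rule F)
  have \<epsilon>: "real n powr (- \<beta>) \<le> 1" for n
    using \<beta> by (cases "n = 0") (auto simp: powr_minus_divide ge_one_powr_ge_zero)
  define A where "A = a powr \<gamma>"
  have A: "0 < A" using ab by (simp add: A_def)
  have "b powr \<gamma> < A" unfolding A_def using ab \<gamma> by (intro powr_less_mono2) auto
  then have "b powr \<gamma> < min (1 - \<beta>) (min ((A - 2 * \<beta> + 1) / 2) A)"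
    using exps by (simp add: A_def)
  from dense[OF this] obtain B where B: "b powr \<gamma> < B" "B < 1 - \<beta>" "2 * B < A - 2 * \<beta> + 1" "B < A"
    by auto
  have B0: "0 < B" using B(1) powr_ge_zero[of b \<gamma>] by linarith
  define d where "d = B powr (1 / \<gamma>)"
  have d\<gamma>: "d powr \<gamma> = B" using B0 \<gamma> by (simp add: d_def powr_powr)
  have "b < d"
  proof (rule ccontr)
    assume "\<not> b < d"
    then have "d powr \<gamma> \<le> b powr \<gamma>" using \<gamma> by (intro powr_mono2) (auto simp: d_def)
    then show False using B(1) d\<gamma> by simp
  qed
  have "d < a"
  proof (rule ccontr)
    assume "\<not> d < a"
    then have "a powr \<gamma> \<le> d powr \<gamma>" using \<gamma> ab by (intro powr_mono2) auto
    then show False using B(4) d\<gamma> by (simp add: A_def)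
  qed
  have "max 0 ((2 * \<beta> - 1 + 2 * B) / A) < 1" using B(3) A by simp
  from dense[OF this] obtain \<theta> where \<theta>: "0 < \<theta>" "\<theta> < 1" "2 * \<beta> - 1 + 2 * B < \<theta> * A"
    using A by (auto simp: divide_less_eq)
  obtain C where C: "0 < C"
    "\<And>t. 0 \<le> t \<Longrightarrow> 1 - cdf (gen_gauss \<gamma>) t \<le> C * exp (- (\<theta> * t powr \<gamma> / \<gamma>))"
    using gen_gauss_tail_le[OF \<gamma> \<theta>(1,2)] by blast
  \<comment> \<open>The quarter leaves a spare power \<open>n powr (2 * \<delta>)\<close> in both
    comparisons, to absorb \<open>\<kappa>\<close>, \<open>C\<close> and the factor 2.\<close>
  define \<delta> where "\<delta> = min (1 - \<beta> - B) (1 - 2 * \<beta> - 2 * B + \<theta> * A) / 4"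
  have \<delta>: "0 < \<delta>" "4 * \<delta> \<le> 1 - \<beta> - B" "4 * \<delta> \<le> 1 - 2 * \<beta> - 2 * B + \<theta> * A"
    using B \<theta> by (auto simp: \<delta>_def min_def)
  define \<kappa> where "\<kappa> = (d - b) / gen_gauss_const \<gamma>"
  have \<kappa>: "0 < \<kappa>" using gen_gauss_const_pos[OF \<gamma>] \<open>b < d\<close> by (simp add: \<kappa>_def)
  define L where "L n = (\<gamma> * ln (real n)) powr (1 / \<gamma>)" for n :: nat
  define \<mu> where "\<mu> n = (\<gamma> * r * ln (real n)) powr (1 / \<gamma>)" for n :: nat
  define G where "G n = contaminated (gen_gauss \<gamma>) (real n powr (- \<beta>)) (\<mu> n)" for n
  have G: "real_distribution (G n)" for n
    unfolding G_def by (rule contaminated_cdf(1)[OF F]) (use \<epsilon> in auto)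
  have sep: "\<forall>\<^sub>F n in sequentially.
      cdf (G n) (a * L n) < cdf (gen_gauss \<gamma>) (a * L n) \<and>
      real n powr (2 * \<delta>) * (1 - cdf (G n) (a * L n))
      \<le> real n * (cdf (gen_gauss \<gamma>) (a * L n) - cdf (G n) (a * L n))\<^sup>2"
  proof -
    have "\<forall>\<^sub>F n :: nat in sequentially. 1 \<le> (\<gamma> * ln (real n)) powr (1 / \<gamma>)"
      using \<gamma> by real_asymp
    moreover have "\<forall>\<^sub>F n :: nat in sequentially. 2 * real n powr (2 * \<delta>) \<le> \<kappa> * real n powr (4 * \<delta>)"
      using \<delta>(1) \<kappa> by real_asymp
    moreover have "\<forall>\<^sub>F n :: nat in sequentially.
        2 * C * real n powr (2 * \<delta>) \<le> \<kappa>\<^sup>2 * real n powr (4 * \<delta>)"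
      using \<delta>(1) \<kappa> C(1) by real_asymp
    ultimately show ?thesis using eventually_ge_at_top[of 2]
    proof eventually_elim
      case (elim n)
      have n: "1 < real n" using elim(4) by simp
      have L1: "1 \<le> L n" using elim(1) by (simp add: L_def)
      have expL: "exp (- (y * (z * L n) powr \<gamma> / \<gamma>)) = real n powr (- (y * z powr \<gamma>))" if "0 \<le> z" for y z
      proof -
        have "(z * L n) powr \<gamma> = z powr \<gamma> * (\<gamma> * ln (real n))"
          using that \<gamma> n by (simp add: powr_mult L_def powr_powr)
        then show ?thesis using n \<gamma> by (simp add: powr_def mult_ac)
      qed
      have \<mu>L: "\<mu> n = r powr (1 / \<gamma>) * L n"
        using r \<gamma> n by (simp add: \<mu>_def L_def powr_mult mult_ac)
      let ?F = "cdf (gen_gauss \<gamma>)"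
      define p where "p = ?F (a * L n)"
      define q where "q = cdf (G n) (a * L n)"
      define D where "D = p - q"
      define D0 where "D0 = \<kappa> * real n powr (- \<beta> - B)"
      have D0: "0 < D0" using \<kappa> n by (simp add: D0_def)
      have "\<kappa> * real n powr (- B) \<le> (d - b) * L n * real n powr (- B) / gen_gauss_const \<gamma>"
        using L1 \<kappa> \<open>b < d\<close> gen_gauss_const_pos[OF \<gamma>]
        by (auto simp: \<kappa>_def intro!: divide_right_mono mult_right_mono)
      also have "\<dots> = (d * L n - b * L n) * exp (- ((d * L n) powr \<gamma> / \<gamma>)) / gen_gauss_const \<gamma>"
        using expL[of d 1] d\<gamma> \<open>b < d\<close> ab by (simp add: algebra_simps)
      also have "\<dots> \<le> ?F (d * L n) - ?F (b * L n)"
      proof (rule gen_gauss_interval_ge[OF \<gamma>])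
        show "b * L n \<le> d * L n" using \<open>b < d\<close> L1 by (intro mult_right_mono) auto
        show "\<bar>x\<bar> \<le> d * L n" if "b * L n < x" "x \<le> d * L n" for x
        proof -
          have "0 \<le> b * L n" using ab L1 by simp
          then show ?thesis using that by simp
        qed
      qed
      \<comment> \<open>The interval from \<open>b * L n\<close> to \<open>d * L n\<close> lies
        inside the one from \<open>a * L n - \<mu> n\<close> to \<open>a * L n\<close>.\<close>
      also have "\<dots> \<le> ?F (a * L n) - ?F (a * L n - \<mu> n)"
      proof (rule diff_mono)
        show "?F (d * L n) \<le> ?F (a * L n)"
          using \<open>d < a\<close> L1 by (intro F.cdf_nondecreasing mult_right_mono) auto
        have "(a - r powr (1 / \<gamma>)) * L n \<le> b * L n" using ab L1 by (intro mult_right_mono) auto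
        then show "?F (a * L n - \<mu> n) \<le> ?F (b * L n)"
          by (intro F.cdf_nondecreasing) (simp add: \<mu>L left_diff_distrib)
      qed
      finally have "real n powr (- \<beta>) * (\<kappa> * real n powr (- B))
          \<le> real n powr (- \<beta>) * (?F (a * L n) - ?F (a * L n - \<mu> n))"
        by (rule mult_left_mono) simp
      moreover have "real n powr (- \<beta>) * (\<kappa> * real n powr (- B)) = D0"
        using powr_add[of "real n" "- \<beta>" "- B"] by (simp add: D0_def)
      ultimately have D0D: "D0 \<le> D"
        using contaminated_cdf_gap[OF F _ \<epsilon>[of n], of "a * L n" "\<mu> n"] n
        by (simp add: D_def p_def q_def G_def)
      have tail: "1 - p \<le> C * real n powr (- (\<theta> * A))"
        using C(2)[of "a * L n"] expL[of a \<theta>] ab L1 by (simp add: p_def A_def)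
      have "2 * real n powr (2 * \<delta>) \<le> \<kappa> * real n powr (1 - \<beta> - B)"
        using elim(2) powr_mono[OF \<delta>(2), of "real n"] n \<kappa> mult_left_mono[of _ _ \<kappa>]
        by (smt (verit, best))
      also have "\<dots> = real n * D0"
        using n powr_add[of "real n" 1 "- \<beta> - B"] by (simp add: D0_def algebra_simps)
      finally have "2 * real n powr (2 * \<delta>) * D \<le> real n * D0 * D"
        using D0 D0D by (intro mult_right_mono) auto
      also have "\<dots> \<le> real n * D * D" using D0 D0D n by (intro mult_right_mono mult_left_mono) auto
      finally have half1: "2 * real n powr (2 * \<delta>) * D \<le> real n * D\<^sup>2"
        by (simp add: power2_eq_square)
      have "2 * C * real n powr (2 * \<delta>) \<le> \<kappa>\<^sup>2 * real n powr (1 - 2 * \<beta> - 2 * B + \<theta> * A)"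
        using elim(3) powr_mono[OF \<delta>(3), of "real n"] n mult_left_mono[of _ _ "\<kappa>\<^sup>2"]
        by (smt (verit, best) zero_le_power2)
      then have "2 * C * real n powr (2 * \<delta>) * real n powr (- (\<theta> * A))
          \<le> \<kappa>\<^sup>2 * real n powr (1 - 2 * \<beta> - 2 * B + \<theta> * A) * real n powr (- (\<theta> * A))"
        by (rule mult_right_mono) simp
      also have "\<dots> = real n * D0\<^sup>2"
        using n powr_add[of "real n" "1 - 2 * \<beta> - 2 * B + \<theta> * A" "- (\<theta> * A)"]
          powr_add[of "real n" 1 "2 * (- \<beta> - B)"] powr_add[of "real n" "- \<beta> - B" "- \<beta> - B"]
        by (simp add: D0_def power_mult_distrib power2_eq_square algebra_simps)
      also have "\<dots> \<le> real n * D\<^sup>2" using D0 D0D by (intro mult_left_mono power_mono) auto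
      finally have "2 * real n powr (2 * \<delta>) * (C * real n powr (- (\<theta> * A))) \<le> real n * D\<^sup>2"
        by (simp add: mult_ac)
      then have half2: "2 * real n powr (2 * \<delta>) * (1 - p) \<le> real n * D\<^sup>2"
        using tail mult_left_mono[OF tail, of "2 * real n powr (2 * \<delta>)"] by simp
      have "real n powr (2 * \<delta>) * (1 - q)
          = real n powr (2 * \<delta>) * (1 - p) + real n powr (2 * \<delta>) * D"
        by (simp add: D_def algebra_simps)
      then have "real n powr (2 * \<delta>) * (1 - q) \<le> real n * D\<^sup>2"
        using half1 half2 by linarith
      then show ?case using D0 D0D by (simp add: D_def p_def q_def)
    qed
  qed
  have "HC_asymptotically_powerful m (gen_gauss \<gamma>) G"
    by (rule HC_powerful_if_separated[OF F isCont_cdf_gen_gauss[OF \<gamma>] always_eventually m \<delta>(1) sep])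
      (use G in auto)
  then show ?thesis by (simp add: G_def[abs_def] \<mu>_def)
qed

text \<open>In the sparse regime the threshold is \<open>a L\<close> with \<open>L = (\<gamma> ln n) powr (1 / \<gamma>)\<close>, and
  \<open>b L\<close> is its position relative to the shifted component, truncated at the mode. Up to subpolynomial
  factors the tails of \<open>F\<close> and of the shifted component there are \<open>n powr (- (a powr \<gamma>))\<close> and
  \<open>n powr (- (b powr \<gamma>))\<close>. The two branches of \<open>rho_star\<close> for \<open>\<gamma> > 1\<close> correspond to the interior
  maximiser of \<open>a powr \<gamma> - 2 * (a - \<rho>) powr \<gamma>\<close> and to the boundary choice \<open>a = 1\<close>.\<close>

lemma rho_star_exponents:
  fixes \<gamma> \<beta> r :: real
  assumes \<gamma>: "0 < \<gamma>" and \<beta>: "1 / 2 < \<beta>" "\<beta> < 1" and r: "0 < r" "r < 1" "rho_star \<gamma> \<beta> < r"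
  shows "\<exists>a b. 0 \<le> b \<and> b < a \<and> a - r powr (1 / \<gamma>) \<le> b \<and> b powr \<gamma> < 1 - \<beta>
    \<and> 2 * \<beta> - 1 < a powr \<gamma> - 2 * b powr \<gamma>"
proof -
  define \<rho> where "\<rho> = r powr (1 / \<gamma>)"
  have \<rho>: "0 < \<rho>" "\<rho> powr \<gamma> = r" using r \<gamma> by (auto simp: \<rho>_def powr_powr)
  have root_mono: "x powr (1 / \<gamma>) < y powr (1 / \<gamma>)" if "0 \<le> x" "x < y" for x y
    using that \<gamma> by (intro powr_less_mono2) auto
  show ?thesis
  proof (cases "\<gamma> \<le> 1")
    case True
    then have "2 * \<beta> - 1 < \<rho> powr \<gamma>" using r \<rho> by (simp add: rho_star_def)
    \<comment> \<open>The threshold sits at the centre of the shifted component.\<close>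
    then show ?thesis using \<rho> \<beta> \<gamma> by (intro exI[of _ \<rho>] exI[of _ 0]) (simp add: \<rho>_def[symmetric])
  next
    case g1: False
    \<comment> \<open>Setting the derivative of
      \<open>a powr \<gamma> - 2 * (a - \<rho>) powr \<gamma>\<close> to zero gives
      \<open>a = c * (a - \<rho>)\<close>.\<close>
    define c where "c = (2 :: real) powr (1 / (\<gamma> - 1))"
    have c1: "1 < c" unfolding c_def using g1 by (intro gr_one_powr) auto
    have cg: "c powr \<gamma> = 2 * c"
      using powr_add[of c "\<gamma> - 1" 1] c1 g1 by (simp add: c_def powr_powr)
    have thr: "2 powr (- (\<gamma> / (\<gamma> - 1))) = 1 / (2 * c)"
    proof -
      have "2 powr (- (\<gamma> / (\<gamma> - 1))) = c powr (- \<gamma>)" by (simp add: c_def powr_powr)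
      then show ?thesis using cg by (simp add: powr_minus_divide)
    qed
    show ?thesis
    proof (cases "\<beta> < 1 - 1 / (2 * c)")
      case True
      \<comment> \<open>The critical shift. The threshold \<open>c * b0\<close> is the optimal one
        for \<open>\<rho>0\<close>, where the second condition holds with equality; the true shift
        \<open>\<rho> > \<rho>0\<close> lowers \<open>b\<close> below \<open>b0\<close> and makes it
        strict. Truncation at 0 covers a shift beyond the threshold.\<close>
      define \<rho>0 where "\<rho>0 = ((c - 1) powr (\<gamma> - 1) * (\<beta> - 1 / 2)) powr (1 / \<gamma>)"
      have "(c - 1) powr (\<gamma> - 1) * (\<beta> - 1 / 2) < r"
        using r True g1 by (simp add: rho_star_def thr c_def[symmetric])
      then have \<rho>0: "0 < \<rho>0" "\<rho>0 < \<rho>"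
        using root_mono[of "(c - 1) powr (\<gamma> - 1) * (\<beta> - 1 / 2)" r] \<beta> c1
        by (auto simp: \<rho>0_def \<rho>_def)
      have \<rho>0g: "\<rho>0 powr \<gamma> = (c - 1) powr (\<gamma> - 1) * (\<beta> - 1 / 2)"
        using \<beta> c1 \<gamma> by (simp add: \<rho>0_def powr_powr)
      define b0 where "b0 = \<rho>0 / (c - 1)"
      have b0: "0 < b0" using \<rho>0 c1 by (simp add: b0_def)
      have a: "c * b0 = b0 + \<rho>0" using c1 by (simp add: b0_def field_simps)
      have "(c - 1) powr \<gamma> = (c - 1) powr (\<gamma> - 1) * (c - 1)"
        using powr_add[of "c - 1" "\<gamma> - 1" 1] c1 by simp
      then have b0g: "b0 powr \<gamma> = (\<beta> - 1 / 2) / (c - 1)"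
        using \<rho>0 c1 \<rho>0g by (simp add: b0_def powr_divide)
      define b where "b = max 0 (c * b0 - \<rho>)"
      have b: "0 \<le> b" "b < b0" "c * b0 - \<rho> \<le> b" using a \<rho>0 b0 by (auto simp: b_def)
      have bg: "b powr \<gamma> < b0 powr \<gamma>" using b \<gamma> by (intro powr_less_mono2) auto
      have "b0 < c * b0" using c1 b0 by simp
      then have "b < c * b0" using b by linarith
      have ag: "(c * b0) powr \<gamma> = 2 * c * b0 powr \<gamma>" using c1 b0 cg by (simp add: powr_mult)
      have "2 * c * b0 powr \<gamma> - 2 * b0 powr \<gamma> = 2 * (c - 1) * b0 powr \<gamma>" by (simp add: algebra_simps)
      also have "\<dots> = 2 * \<beta> - 1" using c1 by (simp add: b0g field_simps)
      finally have e2: "2 * \<beta> - 1 < (c * b0) powr \<gamma> - 2 * b powr \<gamma>" using bg ag by linarith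
      \<comment> \<open>The branch condition on \<open>\<beta>\<close> enters twice: through
        \<open>b0 powr \<gamma> < 1 / (2 * c)\<close> and through
        \<open>1 / (2 * c) < 1 - \<beta>\<close>.\<close>
      have "\<beta> - 1 / 2 < (c - 1) * (1 / (2 * c))" using True c1 by (simp add: field_simps)
      then have "b0 powr \<gamma> < 1 / (2 * c)" using c1 by (simp add: b0g divide_less_eq mult.commute)
      then have e1: "b powr \<gamma> < 1 - \<beta>" using bg True by linarith
      show ?thesis
        using b \<open>b < c * b0\<close> e1 e2 by (intro exI[of _ "c * b0"] exI[of _ b]) (auto simp: \<rho>_def)
    next
      case False
      have w: "0 < (1 - \<beta>) powr (1 / \<gamma>)" "(1 - \<beta>) powr (1 / \<gamma>) < 1"
        using \<beta> root_mono[of "1 - \<beta>" 1] by auto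
      have "(1 - (1 - \<beta>) powr (1 / \<gamma>)) powr \<gamma> < r"
        using r False g1 by (simp add: rho_star_def thr)
      from root_mono[OF _ this] have "1 - (1 - \<beta>) powr (1 / \<gamma>) < \<rho>"
        using w \<gamma> by (simp add: powr_powr \<rho>_def)
      moreover have "\<rho> < 1" using root_mono[of r 1] r by (simp add: \<rho>_def)
      ultimately have b: "0 < 1 - \<rho>" "1 - \<rho> < (1 - \<beta>) powr (1 / \<gamma>)" by auto
      have "(1 - \<rho>) powr \<gamma> < ((1 - \<beta>) powr (1 / \<gamma>)) powr \<gamma>"
        using b \<gamma> by (intro powr_less_mono2) auto
      then have "(1 - \<rho>) powr \<gamma> < 1 - \<beta>" using \<beta> \<gamma> by (simp add: powr_powr)
      \<comment> \<open>For \<open>a = 1\<close> both exponent conditions read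
        \<open>b powr \<gamma> < 1 - \<beta>\<close>.\<close>
      then show ?thesis using b \<rho>
        by (intro exI[of _ 1] exI[of _ "1 - \<rho>"]) (auto simp: \<rho>_def[symmetric])
    qed
  qed
qed

theorem mainTheorem2:
  fixes \<gamma> \<beta> \<eta> :: real and m :: "nat \<Rightarrow> nat"
  assumes "0 < \<gamma>"
    and "0 < \<beta>" and "\<beta> < 1"
    and "0 < \<eta>" and "\<eta> \<le> 1 / 2"
    and "filterlim m at_top sequentially"
    and "(\<lambda>n. real n / real (m n + n)) \<longlonglongrightarrow> \<eta>"
    and "(\<lambda>n. \<bar>real n / real (m n + n) - \<eta>\<bar>) \<in> O(\<lambda>n. ln (real n) / sqrt (real n))"
  shows "(\<forall>r :: real. 1 / 2 < \<beta> \<and> 0 < r \<and> r < 1 \<and> rho_star \<gamma> \<beta> < r \<longrightarrow>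
            HC_asymptotically_powerful m (gen_gauss \<gamma>)
              (\<lambda>n. contaminated (gen_gauss \<gamma>) (real n powr (- \<beta>))
                     ((\<gamma> * r * ln (real n)) powr (1 / \<gamma>))))
       \<and> (\<forall>s :: real. \<beta> < 1 / 2 \<and> 0 < s \<and> s < 1 / 2 \<and> \<beta> < s \<longrightarrow>
            HC_asymptotically_powerful m (gen_gauss \<gamma>)
              (\<lambda>n. contaminated (gen_gauss \<gamma>) (real n powr (- \<beta>))
                     (real n powr (s - 1 / 2))))"
proof -
  \<comment> \<open>The limit is at most 1/2, and a ratio below 2/3 means
    \<open>n < 2 * m n\<close>.\<close>
  have "\<forall>\<^sub>F n in sequentially. real n / real (m n + n) < 2 / 3"
    using order_tendstoD(2)[OF assms(7), of "2 / 3"] assms(5) by simp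
  then have m1: "\<forall>\<^sub>F n in sequentially. real n \<le> 2 * real (m n)"
    using eventually_gt_at_top[of 0]
    by eventually_elim (simp add: divide_less_eq)
  have "\<forall>\<^sub>F n in sequentially. \<eta> / 2 < real n / real (m n + n)"
    using order_tendstoD(1)[OF assms(7), of "\<eta> / 2"] assms(4) by simp
  then have m2: "\<forall>\<^sub>F n in sequentially. real (m n + n) \<le> 2 / \<eta> * real n"
    using eventually_gt_at_top[of 0]
  proof eventually_elim
    case (elim n)
    then have "\<eta> * real (m n + n) < 2 * real n" by (simp add: field_simps)
    then show ?case using assms(4) by (simp add: field_simps)
  qed
  show ?thesis
  proof (intro conjI allI impI)
    fix r :: real
    assume r: "1 / 2 < \<beta> \<and> 0 < r \<and> r < 1 \<and> rho_star \<gamma> \<beta> < r"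
    with rho_star_exponents[OF assms(1) _ assms(3), of r] obtain a b where
      "0 \<le> b" "b < a" "a - r powr (1 / \<gamma>) \<le> b" "b powr \<gamma> < 1 - \<beta>"
      "2 * \<beta> - 1 < a powr \<gamma> - 2 * b powr \<gamma>"
      by blast
    then show "HC_asymptotically_powerful m (gen_gauss \<gamma>)
        (\<lambda>n. contaminated (gen_gauss \<gamma>) (real n powr (- \<beta>))
          ((\<gamma> * r * ln (real n)) powr (1 / \<gamma>)))"
      using gen_gauss_sparse_powerful[OF assms(1,2) _ _ _ _ _ _ m1 m2] r by blast
  next
    fix s :: real
    assume "\<beta> < 1 / 2 \<and> 0 < s \<and> s < 1 / 2 \<and> \<beta> < s"
    then show "HC_asymptotically_powerful m (gen_gauss \<gamma>)
        (\<lambda>n. contaminated (gen_gauss \<gamma>) (real n powr (- \<beta>)) (real n powr (s - 1 / 2)))"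
      using gen_gauss_dense_powerful[OF assms(1,2) _ _ m1 m2] by blast
  qed
qed

end
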